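(* Let $(X,\omega_1,\omega_2,\mathbf{g})$ be an almost $2$-Kähler manifold with dualizing form $\omega_D$. Let $\mathbf{L}_0,\mathbf{L}_1,\mathbf{L}_2$ be the operators on $\Lambda^*T^*X$ given by $\mathbf{L}_0(\alpha)=\omega_D\wedge\alpha$, $\mathbf{L}_1(\alpha)=\omega_1\wedge\alpha$, $\mathbf{L}_2(\alpha)=\omega_2\wedge\alpha$, and let $\mathbf{L}_i^*$ be their pointwise adjoints with respect to $\mathbf{g}$. Then the operators $\mathbf{L}_0,\mathbf{L}_1,\mathbf{L}_2,\mathbf{L}_0^*,\mathbf{L}_1^*,\mathbf{L}_2^*$ generate (under commutators, over $\mathbb{R}$) a Lie algebra naturally isomorphic to $\mathbf{sl}(4,\mathbb{R})$ acting on the bundle $\Lambda^*T^*X$.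
   Context: For a $2$-form $\alpha$, $\alpha^\perp$ is the distribution of vectors $v$ with $\iota_v\alpha=0$. An almost $2$-Kähler manifold $(X,\omega_1,\omega_2,\mathbf{g})$ is a $3n$-dimensional smooth manifold with closed $2$-forms $\omega_1,\omega_2$ and a Riemannian metric $\mathbf{g}$ such that $\omega_1^\perp+\omega_2^\perp$ is integrable and each $T_pX$ has an orthonormal basis $v_1,\dots,v_n,w^1_1,\dots,w^1_n,w^2_1,\dots,w^2_n$ with $\omega_j=\sum_i v_i^*\wedge (w_i^j)^*$ (an orthonormal standard polysymplectic basis). Its dualizing form is $\omega_D=\sum_i(w_i^1)^*\wedge (w_i^2)^*$, independent of the choice of such basis. The adjoint is defined pointwise by $\mathbf{g}(\mathbf{L}_i\alpha,\beta)=\mathbf{g}(\alpha,\mathbf{L}_i^*\beta)$ for all $\alpha,\beta\in\Lambda^*T_p^*X$. *)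

theory Defs
  imports "HOL-Analysis.Analysis"
begin

section \<open>The exterior algebra of the dual of a finite-dimensional vector space\<close>

text \<open>
  An element of \<open>\<Lambda>\<^sup>* E\<^sup>*\<close> is a family of alternating \<open>k\<close>-linear forms on \<open>E\<close>, one for each \<open>k\<close>;
  it is encoded as one real function on lists of vectors, whose restriction to lists of
  length \<open>k\<close> is the component of degree \<open>k\<close>. The components of degree \<open>k > dim E\<close> vanish
  automatically.
\<close>

definition alternating_multilinear :: "('e::euclidean_space list \<Rightarrow> real) \<Rightarrow> bool" where
  "alternating_multilinear f \<longleftrightarrow>
     (\<forall>xs ys. linear (\<lambda>v. f (xs @ v # ys))) \<and> (\<forall>vs. \<not> distinct vs \<longrightarrow> f vs = 0)"

typedef (overloaded) 'e::euclidean_space alt_form =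
  "{f :: 'e list \<Rightarrow> real. alternating_multilinear f}"
  morphisms form_apply Alt_form
  by (rule exI[of _ "\<lambda>_. 0"]) (simp add: alternating_multilinear_def linear_zero)

setup_lifting type_definition_alt_form

instantiation alt_form :: (euclidean_space) real_vector
begin

lift_definition zero_alt_form :: "'a alt_form" is "\<lambda>_. 0"
  by (simp add: alternating_multilinear_def linear_zero)

lift_definition plus_alt_form :: "'a alt_form \<Rightarrow> 'a alt_form \<Rightarrow> 'a alt_form"
  is "\<lambda>f g vs. f vs + g vs"
  by (simp add: alternating_multilinear_def linear_compose_add)

lift_definition uminus_alt_form :: "'a alt_form \<Rightarrow> 'a alt_form" is "\<lambda>f vs. - f vs"
  by (simp add: alternating_multilinear_def linear_compose_neg)

lift_definition minus_alt_form :: "'a alt_form \<Rightarrow> 'a alt_form \<Rightarrow> 'a alt_form"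
  is "\<lambda>f g vs. f vs - g vs"
  by (simp add: alternating_multilinear_def linear_compose_sub)

lift_definition scaleR_alt_form :: "real \<Rightarrow> 'a alt_form \<Rightarrow> 'a alt_form"
  is "\<lambda>c f vs. c * f vs"
  using linear_compose_scale_right by (fastforce simp: alternating_multilinear_def)

instance
  by standard (transfer; simp add: fun_eq_iff algebra_simps)+

end

definition homogeneous_form :: "nat \<Rightarrow> 'e::euclidean_space alt_form \<Rightarrow> bool" where
  "homogeneous_form k \<alpha> \<longleftrightarrow> (\<forall>vs. length vs \<noteq> k \<longrightarrow> form_apply \<alpha> vs = 0)"

text \<open>
  The wedge product as a sum over shuffles: \<open>I\<close> is the set of positions whose vectors are fed to
  the left factor, and the exponent counts the inversions of the corresponding shuffle.
\<close>

definition wedge_fun :: "('e list \<Rightarrow> real) \<Rightarrow> ('e list \<Rightarrow> real) \<Rightarrow> 'e list \<Rightarrow> real" where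
  "wedge_fun f g vs =
     (\<Sum>I\<in>Pow {..<length vs}.
        (-1) ^ card {(i, j). i \<in> {..<length vs} - I \<and> j \<in> I \<and> i < j}
        * f (nths vs I) * g (nths vs ({..<length vs} - I)))"

lemma nths_Cons_Suc_image: "nths (v # vs) (Suc ` J) = nths vs J"
  by (simp add: nths_Cons inj_image_mem_iff)

lemma nths_Cons_insert_0: "nths (v # vs) (insert 0 (Suc ` J)) = v # nths vs J"
  by (simp add: nths_Cons inj_image_mem_iff)

lemma wedge_fun_Nil: "wedge_fun f g [] = f [] * g []"
  by (simp add: wedge_fun_def)

lemma wedge_fun_Cons:
  "wedge_fun f g (v # vs) =
     wedge_fun (\<lambda>xs. f (v # xs)) g vs
     + wedge_fun (\<lambda>xs. (-1) ^ length xs * f xs) (\<lambda>xs. g (v # xs)) vs"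
proof -
  define m where "m = length vs"
  define P where "P = Pow {..<m}"
  define inv where "inv = (\<lambda>k I. {(i, j). i \<in> {..<k} - I \<and> j \<in> I \<and> i < (j::nat)})"
  define t where "t = (\<lambda>I. (-1) ^ card (inv (Suc m) I)
        * f (nths (v # vs) I) * g (nths (v # vs) ({..<Suc m} - I)))"
  have P_eq: "Pow {..<Suc m} = (`) Suc ` P \<union> (\<lambda>J. insert 0 (Suc ` J)) ` P"
    by (simp add: lessThan_Suc_eq_insert_0 Pow_insert P_def image_Pow_surj[OF refl, symmetric] image_image)
  have inj1: "inj_on ((`) Suc) P" by (auto simp: inj_on_def inj_image_eq_iff)
  have inj2: "inj_on (\<lambda>J. insert 0 (Suc ` J)) P"
  proof (rule inj_onI)
    fix J K assume "insert 0 (Suc ` J) = insert 0 (Suc ` K)"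
    then have "Suc ` J = Suc ` K" by (metis Diff_insert_absorb image_iff nat.distinct(1))
    then show "J = K" by (simp add: inj_image_eq_iff)
  qed
  have disj: "(`) Suc ` P \<inter> (\<lambda>J. insert 0 (Suc ` J)) ` P = {}" by auto
  have finP: "finite P" by (simp add: P_def)
  have pc: "inj_on (\<lambda>(i, j). (Suc i, Suc j)) S" for S by (auto simp: inj_on_def)
  have inv_fin: "finite (inv m J)" if "J \<in> P" for J
    by (rule finite_subset[of _ "{..<m} \<times> {..<m}"]) (use that in \<open>auto simp: inv_def P_def\<close>)
  have mem: "(i, j) \<in> (\<lambda>(i, j). (Suc i, Suc j)) ` S
      \<longleftrightarrow> (\<exists>a b. i = Suc a \<and> j = Suc b \<and> (a, b) \<in> S)" for i j S
    by auto
  have inv1: "inv (Suc m) (insert 0 (Suc ` J)) = (\<lambda>(i, j). (Suc i, Suc j)) ` inv m J" for J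
  proof (rule set_eqI, clarify)
    fix i j
    show "(i, j) \<in> inv (Suc m) (insert 0 (Suc ` J))
        \<longleftrightarrow> (i, j) \<in> (\<lambda>(i, j). (Suc i, Suc j)) ` inv m J"
      unfolding mem by (cases i; cases j) (auto simp: inv_def)
  qed
  have inv2: "inv (Suc m) (Suc ` J) = (\<lambda>(i, j). (Suc i, Suc j)) ` inv m J \<union> {0} \<times> Suc ` J" for J
  proof (rule set_eqI, clarify)
    fix i j
    show "(i, j) \<in> inv (Suc m) (Suc ` J)
        \<longleftrightarrow> (i, j) \<in> (\<lambda>(i, j). (Suc i, Suc j)) ` inv m J \<union> {0} \<times> Suc ` J"
      unfolding Un_iff mem by (cases i; cases j) (auto simp: inv_def)
  qed
  have c1: "card (inv (Suc m) (insert 0 (Suc ` J))) = card (inv m J)" for J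
    unfolding inv1 by (rule card_image[OF pc])
  have c2: "card (inv (Suc m) (Suc ` J)) = card (inv m J) + card J" if "J \<in> P" for J
  proof -
    have "finite J" using that by (auto simp: P_def intro: finite_subset)
    then show ?thesis
      unfolding inv2
      by (subst card_Un_disjoint)
        (auto simp: inv_fin[OF that] card_image[OF pc] card_cartesian_product_singleton card_image)
  qed
  have d1: "{..<Suc m} - insert 0 (Suc ` J) = Suc ` ({..<m} - J)" for J
    by (auto simp: lessThan_Suc_eq_insert_0)
  have d2: "{..<Suc m} - Suc ` J = insert 0 (Suc ` ({..<m} - J))" for J
    by (auto simp: lessThan_Suc_eq_insert_0)
  have len: "length (nths vs J) = card J" if "J \<in> P" for J
  proof -
    have "{i. i < length vs \<and> i \<in> J} = J" using that by (auto simp: P_def m_def)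
    then show ?thesis by (simp add: length_nths)
  qed
  have W: "wedge_fun F G vs = (\<Sum>J\<in>P. (-1) ^ card (inv m J)
      * F (nths vs J) * G (nths vs ({..<m} - J)))" for F G
    by (simp only: wedge_fun_def P_def inv_def m_def)
  have "wedge_fun f g (v # vs) = sum t (Pow {..<Suc m})"
    by (simp add: wedge_fun_def t_def inv_def m_def)
  also have "\<dots> = sum t ((`) Suc ` P) + sum t ((\<lambda>J. insert 0 (Suc ` J)) ` P)"
    unfolding P_eq by (rule sum.union_disjoint) (use finP disj in auto)
  also have "sum t ((\<lambda>J. insert 0 (Suc ` J)) ` P) = wedge_fun (\<lambda>xs. f (v # xs)) g vs"
    by (simp add: sum.reindex[OF inj2] t_def c1 d1 nths_Cons_Suc_image nths_Cons_insert_0 W)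
  also have "sum t ((`) Suc ` P)
      = wedge_fun (\<lambda>xs. (-1) ^ length xs * f xs) (\<lambda>xs. g (v # xs)) vs"
    unfolding sum.reindex[OF inj1] W comp_def
    by (rule sum.cong)
      (simp_all add: t_def c2 d2 len power_add nths_Cons_Suc_image nths_Cons_insert_0)
  finally show ?thesis by simp
qed

lemma wedge_fun_linear_left:
  assumes "\<And>xs. linear (\<lambda>v. F v xs)"
  shows "linear (\<lambda>v. wedge_fun (F v) g vs)"
  unfolding wedge_fun_def
  by (rule linearI)
    (simp_all add: linear_add[OF assms] linear_scale[OF assms] algebra_simps sum.distrib
      sum_distrib_left)

lemma wedge_fun_linear_right:
  assumes "\<And>xs. linear (\<lambda>v. G v xs)"
  shows "linear (\<lambda>v. wedge_fun f (G v) vs)"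
  unfolding wedge_fun_def
  by (rule linearI)
    (simp_all add: linear_add[OF assms] linear_scale[OF assms] algebra_simps sum.distrib
      sum_distrib_left)

lemma wedge_fun_uminus_left: "wedge_fun (\<lambda>xs. - f xs) g vs = - wedge_fun f g vs"
  by (simp add: wedge_fun_def sum_negf)

lemma wedge_fun_zero: "wedge_fun (\<lambda>_. 0) g vs = 0" "wedge_fun f (\<lambda>_. 0) vs = 0"
  by (simp_all add: wedge_fun_def)

lemma alternating_multilinear_Cons:
  assumes "alternating_multilinear f"
  shows "alternating_multilinear (\<lambda>xs. f (v # xs))"
proof -
  have "linear (\<lambda>u. f (v # xs @ u # ys))" for xs ys
  proof -
    have "linear (\<lambda>u. f ((v # xs) @ u # ys))"
      using assms unfolding alternating_multilinear_def by blast
    then show ?thesis by simp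
  qed
  then show ?thesis using assms by (simp add: alternating_multilinear_def)
qed

lemma alternating_multilinear_sign:
  assumes "alternating_multilinear f"
  shows "alternating_multilinear (\<lambda>xs. (-1) ^ length xs * f xs)"
proof -
  have "linear (\<lambda>v. (-1) ^ length (xs @ v # ys) * f (xs @ v # ys))" for xs ys
  proof -
    have "linear (\<lambda>v. (-1) ^ length (xs @ undefined # ys) *\<^sub>R f (xs @ v # ys))"
      using assms by (intro linear_compose_scale_right) (simp add: alternating_multilinear_def)
    then show ?thesis by simp
  qed
  then show ?thesis using assms by (simp add: alternating_multilinear_def)
qed

lemma wedge_fun_linear:
  assumes "alternating_multilinear f" "alternating_multilinear g"
  shows "linear (\<lambda>v. wedge_fun f g (xs @ v # ys))"
  using assms
proof (induction xs arbitrary: f g)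
  case Nil
  have f: "linear (\<lambda>v. f (v # xs))" and g: "linear (\<lambda>v. g (v # xs))" for xs
    using Nil[unfolded alternating_multilinear_def, THEN conjunct1, THEN spec, of "[]"] by simp_all
  show ?case
    unfolding wedge_fun_Cons append_Nil
    by (intro linear_compose_add wedge_fun_linear_left wedge_fun_linear_right f g)
next
  case (Cons x xs)
  then show ?case
    unfolding wedge_fun_Cons append_Cons
    by (intro linear_compose_add Cons.IH alternating_multilinear_Cons alternating_multilinear_sign)
qed

lemma wedge_fun_adjacent:
  assumes "alternating_multilinear f" "alternating_multilinear g"
  shows "wedge_fun f g (xs @ v # v # ys) = 0"
  using assms
proof (induction xs arbitrary: f g)
  case Nil
  have "f (v # v # xs) = 0" "g (v # v # xs) = 0" for xs
    using Nil by (auto simp: alternating_multilinear_def)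
  then show ?case
    by (simp add: wedge_fun_Cons wedge_fun_zero wedge_fun_uminus_left)
next
  case (Cons x xs)
  then show ?case
    unfolding wedge_fun_Cons append_Cons
    by (simp add: Cons.IH alternating_multilinear_Cons alternating_multilinear_sign)
qed

lemma wedge_fun_repeated:
  assumes fg: "alternating_multilinear f" "alternating_multilinear g"
  shows "wedge_fun f g (xs @ v # ys @ v # zs) = 0"
proof (induction ys arbitrary: xs)
  case Nil
  then show ?case using wedge_fun_adjacent[OF fg] by simp
next
  case (Cons y ys)
  let ?w = "\<lambda>a b. wedge_fun f g (xs @ a # b # ys @ v # zs)"
  have l1: "linear (\<lambda>a. ?w a b)" for b
    using wedge_fun_linear[OF fg] by simp
  have l2: "linear (?w a)" for a
    using wedge_fun_linear[OF fg, of "xs @ [a]"] by simp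
  have d: "?w a a = 0" for a
    using wedge_fun_adjacent[OF fg] by simp
  have "?w (v + y) (v + y) = ?w v (v + y) + ?w y (v + y)"
    by (rule linear_add[OF l1])
  also have "?w v (v + y) = ?w v v + ?w v y"
    by (rule linear_add[OF l2])
  also have "?w y (v + y) = ?w y v + ?w y y"
    by (rule linear_add[OF l2])
  finally have "?w v y + ?w y v = 0"
    unfolding d by simp
  moreover have "?w y v = 0"
    using Cons.IH[of "xs @ [y]"] by simp
  ultimately show ?case by simp
qed

lemma alternating_multilinear_wedge_fun:
  assumes "alternating_multilinear f" "alternating_multilinear g"
  shows "alternating_multilinear (wedge_fun f g)"
proof -
  have "wedge_fun f g vs = 0" if rep: "\<not> distinct vs" for vs
  proof -
    obtain xs ys zs v where "vs = xs @ [v] @ ys @ [v] @ zs"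
      using not_distinct_decomp[OF rep] by blast
    then show ?thesis using wedge_fun_repeated[OF assms] by simp
  qed
  then show ?thesis using wedge_fun_linear[OF assms] by (simp add: alternating_multilinear_def)
qed

lift_definition wedge :: "'e::euclidean_space alt_form \<Rightarrow> 'e alt_form \<Rightarrow> 'e alt_form"
  (infixr "\<and>\<^sub>F" 70) is wedge_fun
  by (rule alternating_multilinear_wedge_fun)

lift_definition interior_product :: "'e::euclidean_space \<Rightarrow> 'e alt_form \<Rightarrow> 'e alt_form"
  is "\<lambda>v f xs. f (v # xs)"
  by (rule alternating_multilinear_Cons)

lift_definition covector_form :: "('e::euclidean_space \<Rightarrow>\<^sub>L real) \<Rightarrow> 'e alt_form"
  is "\<lambda>\<theta> xs. case xs of [x] \<Rightarrow> blinfun_apply \<theta> x | _ \<Rightarrow> 0"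
proof -
  fix \<theta> :: "'e \<Rightarrow>\<^sub>L real"
  let ?f = "\<lambda>xs. case xs of [x] \<Rightarrow> blinfun_apply \<theta> x | _ \<Rightarrow> 0"
  have "linear (\<lambda>v. ?f (xs @ v # ys))" for xs ys
  proof (cases "xs = [] \<and> ys = []")
    case True
    then show ?thesis by (simp add: blinfun.bounded_linear_right bounded_linear.linear)
  next
    case False
    then have "?f (xs @ v # ys) = 0" for v
      by (auto split: list.splits simp: append_eq_Cons_conv)
    then show ?thesis by (simp add: linear_zero)
  qed
  moreover have "?f vs = 0" if "\<not> distinct vs" for vs
    using that by (auto split: list.splits)
  ultimately show "alternating_multilinear ?f" by (simp add: alternating_multilinear_def)
qed

definition orthonormal_basis ::
    "('e::euclidean_space \<Rightarrow>\<^sub>L 'e \<Rightarrow>\<^sub>L real) \<Rightarrow> 'e list \<Rightarrow> bool" where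
  "orthonormal_basis h E \<longleftrightarrow>
     (\<forall>i<length E. \<forall>j<length E. h (E ! i) (E ! j) = (if i = j then 1 else 0))
     \<and> span (set E) = UNIV"

text \<open>
  The inner product induced by \<open>h\<close> on the exterior algebra, normalised as usual so that the
  products \<open>e\<^sub>i\<^sub>1\<^sup>* \<and> \<dots> \<and> e\<^sub>i\<^sub>k\<^sup>*\<close> (\<open>i\<^sub>1 < \<dots> < i\<^sub>k\<close>) of a dual orthonormal basis are orthonormal;
  it does not depend on the orthonormal basis \<open>E\<close> that is selected.
\<close>

definition form_inner ::
    "('e::euclidean_space \<Rightarrow>\<^sub>L 'e \<Rightarrow>\<^sub>L real) \<Rightarrow> 'e alt_form \<Rightarrow> 'e alt_form \<Rightarrow> real" where
  "form_inner h \<alpha> \<beta> =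
     (let E = (SOME E. orthonormal_basis h E)
      in \<Sum>I\<in>Pow {..<length E}. form_apply \<alpha> (nths E I) * form_apply \<beta> (nths E I))"


section \<open>Smooth manifolds\<close>

text \<open>The set \<open>S\<close> is meant to be open: derivatives are two-sided at every point of \<open>S\<close>.\<close>

primrec Ck_on ::
    "nat \<Rightarrow> 'a::euclidean_space set \<Rightarrow> ('a \<Rightarrow> 'b::real_normed_vector) \<Rightarrow> bool" where
  "Ck_on 0 S f \<longleftrightarrow> continuous_on S f"
| "Ck_on (Suc k) S f \<longleftrightarrow>
     (\<forall>x\<in>S. f differentiable (at x)) \<and>
     (\<forall>v. Ck_on k S (\<lambda>x. frechet_derivative f (at x) v))"

definition smooth_on ::
    "'a::euclidean_space set \<Rightarrow> ('a \<Rightarrow> 'b::real_normed_vector) \<Rightarrow> bool" where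
  "smooth_on S f \<longleftrightarrow> (\<forall>k. Ck_on k S f)"

text \<open>
  A manifold is the whole of a Hausdorff second countable space \<open>'x\<close>, modelled on the Euclidean
  space \<open>'e\<close>; a chart is a pair of its domain and its coordinate map.
\<close>

type_synonym ('x, 'e) chart = "'x set \<times> ('x \<Rightarrow> 'e)"

definition chart_image :: "('x, 'e) chart \<Rightarrow> 'e set" where
  "chart_image c = snd c ` fst c"

definition chart_inv :: "('x, 'e) chart \<Rightarrow> 'e \<Rightarrow> 'x" where
  "chart_inv c = inv_into (fst c) (snd c)"

definition smooth_atlas ::
    "('x::{t2_space, second_countable_topology}, 'e::euclidean_space) chart set \<Rightarrow> bool" where
  "smooth_atlas A \<longleftrightarrow>
     (\<forall>c\<in>A. open (fst c) \<and> open (chart_image c)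
            \<and> homeomorphism (fst c) (chart_image c) (snd c) (chart_inv c))
     \<and> (\<Union>c\<in>A. fst c) = UNIV
     \<and> (\<forall>c\<in>A. \<forall>d\<in>A. smooth_on (snd c ` (fst c \<inter> fst d)) (snd d \<circ> chart_inv c))"

definition chart_at :: "('x, 'e) chart set \<Rightarrow> 'x \<Rightarrow> ('x, 'e) chart" where
  "chart_at A p = (SOME c. c \<in> A \<and> p \<in> fst c)"

text \<open>
  The tangent space \<open>T\<^sub>pX\<close> is represented by the model space \<open>'e\<close>, a tangent vector being given by
  its components in the preferred chart \<open>chart_at A p\<close>. Consequently a form, a metric or a
  distribution is a function of \<open>p\<close> with values in objects on \<open>'e\<close>, and every local notion has to
  be expressed through the change of components between \<open>chart_at A p\<close> and the chart in use:
  \<open>to_tangent A c x\<close> takes the components of a tangent vector at the point \<open>p\<close> with coordinates \<open>x\<close>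
  in the chart \<open>c\<close> to its components in \<open>chart_at A p\<close>, \<open>from_tangent A c p\<close> goes the other way.
\<close>

definition to_tangent ::
    "('x, 'e::euclidean_space) chart set \<Rightarrow> ('x, 'e) chart \<Rightarrow> 'e \<Rightarrow> 'e \<Rightarrow> 'e" where
  "to_tangent A c x =
     frechet_derivative (snd (chart_at A (chart_inv c x)) \<circ> chart_inv c) (at x)"

definition from_tangent ::
    "('x, 'e::euclidean_space) chart set \<Rightarrow> ('x, 'e) chart \<Rightarrow> 'x \<Rightarrow> 'e \<Rightarrow> 'e" where
  "from_tangent A c p =
     frechet_derivative (snd c \<circ> chart_inv (chart_at A p)) (at (snd (chart_at A p) p))"

definition form_in_chart ::
    "('x, 'e::euclidean_space) chart set \<Rightarrow> ('x, 'e) chart \<Rightarrow> ('x \<Rightarrow> 'e alt_form)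
      \<Rightarrow> 'e \<Rightarrow> 'e list \<Rightarrow> real" where
  "form_in_chart A c \<omega> x vs =
     form_apply (\<omega> (chart_inv c x)) (map (to_tangent A c x) vs)"

definition metric_in_chart ::
    "('x, 'e::euclidean_space) chart set \<Rightarrow> ('x, 'e) chart \<Rightarrow> ('x \<Rightarrow> 'e \<Rightarrow>\<^sub>L 'e \<Rightarrow>\<^sub>L real)
      \<Rightarrow> 'e \<Rightarrow> 'e \<Rightarrow> 'e \<Rightarrow> real" where
  "metric_in_chart A c g x u v =
     g (chart_inv c x) (to_tangent A c x u) (to_tangent A c x v)"

definition differential_form ::
    "('x, 'e::euclidean_space) chart set \<Rightarrow> nat \<Rightarrow> ('x \<Rightarrow> 'e alt_form) \<Rightarrow> bool" where
  "differential_form A k \<omega> \<longleftrightarrow>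
     (\<forall>p. homogeneous_form k (\<omega> p))
     \<and> (\<forall>c\<in>A. \<forall>vs. smooth_on (chart_image c) (\<lambda>x. form_in_chart A c \<omega> x vs))"

text \<open>The exterior derivative of a coordinate expression, evaluated on constant vector fields.\<close>

definition coord_exterior_derivative ::
    "('e::euclidean_space \<Rightarrow> 'e list \<Rightarrow> real) \<Rightarrow> 'e \<Rightarrow> 'e list \<Rightarrow> real" where
  "coord_exterior_derivative f x vs =
     (\<Sum>i<length vs. (-1) ^ i
        * frechet_derivative (\<lambda>y. f y (take i vs @ drop (Suc i) vs)) (at x) (vs ! i))"

definition closed_form ::
    "('x, 'e::euclidean_space) chart set \<Rightarrow> ('x \<Rightarrow> 'e alt_form) \<Rightarrow> bool" where
  "closed_form A \<omega> \<longleftrightarrow>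
     (\<forall>c\<in>A. \<forall>x\<in>chart_image c. \<forall>vs.
        coord_exterior_derivative (form_in_chart A c \<omega>) x vs = 0)"

definition Riemannian_metric ::
    "('x, 'e::euclidean_space) chart set \<Rightarrow> ('x \<Rightarrow> 'e \<Rightarrow>\<^sub>L 'e \<Rightarrow>\<^sub>L real) \<Rightarrow> bool" where
  "Riemannian_metric A g \<longleftrightarrow>
     (\<forall>p u v. g p u v = g p v u)
     \<and> (\<forall>p v. v \<noteq> 0 \<longrightarrow> g p v v > 0)
     \<and> (\<forall>c\<in>A. \<forall>u v. smooth_on (chart_image c) (\<lambda>x. metric_in_chart A c g x u v))"

text \<open>
  Integrability of a distribution: around every point there is a chart of the smooth structure
  (not necessarily one of the given atlas) in which the distribution is a constant subspace.
\<close>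

definition integrable_distribution ::
    "('x::{t2_space, second_countable_topology}, 'e::euclidean_space) chart set
      \<Rightarrow> ('x \<Rightarrow> 'e set) \<Rightarrow> bool" where
  "integrable_distribution A D \<longleftrightarrow>
     (\<forall>p. \<exists>c S. smooth_atlas (insert c A) \<and> p \<in> fst c \<and> subspace S
        \<and> (\<forall>q\<in>fst c. from_tangent A c q ` D q = S))"


section \<open>Almost 2-Kaehler manifolds\<close>

definition form_perp :: "'e::euclidean_space alt_form \<Rightarrow> 'e set" where
  "form_perp \<alpha> = {v. interior_product v \<alpha> = 0}"

text \<open>
  \<open>covector_form (h u)\<close> is the covector \<open>h(u, _)\<close>; for a member \<open>u\<close> of an \<open>h\<close>-orthonormal basis
  it is the element \<open>u\<^sup>*\<close> of the dual basis.
\<close>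

definition orthonormal_std_basis ::
    "nat \<Rightarrow> ('e::euclidean_space \<Rightarrow>\<^sub>L 'e \<Rightarrow>\<^sub>L real) \<Rightarrow> 'e alt_form \<Rightarrow> 'e alt_form
      \<Rightarrow> (nat \<Rightarrow> 'e) \<Rightarrow> (nat \<Rightarrow> 'e) \<Rightarrow> (nat \<Rightarrow> 'e) \<Rightarrow> bool" where
  "orthonormal_std_basis n h \<omega>1 \<omega>2 v w1 w2 \<longleftrightarrow>
     orthonormal_basis h (map v [0..<n] @ map w1 [0..<n] @ map w2 [0..<n])
     \<and> \<omega>1 = (\<Sum>i<n. covector_form (h (v i)) \<and>\<^sub>F covector_form (h (w1 i)))
     \<and> \<omega>2 = (\<Sum>i<n. covector_form (h (v i)) \<and>\<^sub>F covector_form (h (w2 i)))"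

definition almost_2_Kaehler ::
    "nat \<Rightarrow> ('x::{t2_space, second_countable_topology}, 'e::euclidean_space) chart set
      \<Rightarrow> ('x \<Rightarrow> 'e alt_form) \<Rightarrow> ('x \<Rightarrow> 'e alt_form) \<Rightarrow> ('x \<Rightarrow> 'e \<Rightarrow>\<^sub>L 'e \<Rightarrow>\<^sub>L real) \<Rightarrow> bool" where
  "almost_2_Kaehler n A \<omega>1 \<omega>2 g \<longleftrightarrow>
     DIM('e) = 3 * n
     \<and> smooth_atlas A
     \<and> differential_form A 2 \<omega>1 \<and> closed_form A \<omega>1
     \<and> differential_form A 2 \<omega>2 \<and> closed_form A \<omega>2
     \<and> Riemannian_metric A g
     \<and> integrable_distribution A
          (\<lambda>p. {u + v | u v. u \<in> form_perp (\<omega>1 p) \<and> v \<in> form_perp (\<omega>2 p)})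
     \<and> (\<forall>p. \<exists>v w1 w2. orthonormal_std_basis n (g p) (\<omega>1 p) (\<omega>2 p) v w1 w2)"

text \<open>One basis at each point suffices here, as the sum is the same for all of them.\<close>

definition dualizing_form ::
    "nat \<Rightarrow> ('x \<Rightarrow> 'e::euclidean_space alt_form) \<Rightarrow> ('x \<Rightarrow> 'e alt_form)
      \<Rightarrow> ('x \<Rightarrow> 'e \<Rightarrow>\<^sub>L 'e \<Rightarrow>\<^sub>L real) \<Rightarrow> ('x \<Rightarrow> 'e alt_form) \<Rightarrow> bool" where
  "dualizing_form n \<omega>1 \<omega>2 g \<omega>D \<longleftrightarrow>
     (\<forall>p. \<exists>v w1 w2. orthonormal_std_basis n (g p) (\<omega>1 p) (\<omega>2 p) v w1 w2
        \<and> \<omega>D p = (\<Sum>i<n. covector_form (g p (w1 i)) \<and>\<^sub>F covector_form (g p (w2 i))))"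


section \<open>Operators on the bundle of forms\<close>

text \<open>
  A fibre-preserving operator on \<open>\<Lambda>\<^sup>*T\<^sup>*X\<close> is a family of maps of the fibres \<open>\<Lambda>\<^sup>*T\<^sub>p\<^sup>*X\<close>.
\<close>

type_synonym ('x, 'e) bundle_op = "'x \<Rightarrow> 'e alt_form \<Rightarrow> 'e alt_form"

definition op_add ::
    "('x, 'e::euclidean_space) bundle_op \<Rightarrow> ('x, 'e) bundle_op \<Rightarrow> ('x, 'e) bundle_op" where
  "op_add S T = (\<lambda>p \<alpha>. S p \<alpha> + T p \<alpha>)"

definition op_scale ::
    "real \<Rightarrow> ('x, 'e::euclidean_space) bundle_op \<Rightarrow> ('x, 'e) bundle_op" where
  "op_scale r S = (\<lambda>p \<alpha>. r *\<^sub>R S p \<alpha>)"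

definition op_commutator ::
    "('x, 'e::euclidean_space) bundle_op \<Rightarrow> ('x, 'e) bundle_op \<Rightarrow> ('x, 'e) bundle_op" where
  "op_commutator S T = (\<lambda>p \<alpha>. S p (T p \<alpha>) - T p (S p \<alpha>))"

inductive_set generated_Lie_algebra ::
    "('x, 'e::euclidean_space) bundle_op set \<Rightarrow> ('x, 'e) bundle_op set"
  for G :: "('x, 'e) bundle_op set" where
  generator: "S \<in> G \<Longrightarrow> S \<in> generated_Lie_algebra G"
| zero: "(\<lambda>p \<alpha>. 0) \<in> generated_Lie_algebra G"
| add: "S \<in> generated_Lie_algebra G \<Longrightarrow> T \<in> generated_Lie_algebra G
    \<Longrightarrow> op_add S T \<in> generated_Lie_algebra G"
| scale: "S \<in> generated_Lie_algebra G \<Longrightarrow> op_scale r S \<in> generated_Lie_algebra G"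
| commutator: "S \<in> generated_Lie_algebra G \<Longrightarrow> T \<in> generated_Lie_algebra G
    \<Longrightarrow> op_commutator S T \<in> generated_Lie_algebra G"

definition wedge_op :: "('x \<Rightarrow> 'e::euclidean_space alt_form) \<Rightarrow> ('x, 'e) bundle_op" where
  "wedge_op \<omega> = (\<lambda>p \<alpha>. \<omega> p \<and>\<^sub>F \<alpha>)"

definition adjoint_op ::
    "('x \<Rightarrow> 'e::euclidean_space \<Rightarrow>\<^sub>L 'e \<Rightarrow>\<^sub>L real) \<Rightarrow> ('x, 'e) bundle_op \<Rightarrow> ('x, 'e) bundle_op" where
  "adjoint_op g S =
     (\<lambda>p. SOME T. \<forall>\<alpha> \<beta>. form_inner (g p) (S p \<alpha>) \<beta> = form_inner (g p) \<alpha> (T \<beta>))"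


section \<open>The Lie algebra sl(4,R)\<close>

definition sl4 :: "(real^4^4) set" where
  "sl4 = {M. trace M = 0}"

text \<open>
  The natural identification sends \<open>matrix_unit i 0\<close> (\<open>i = 1, 2, 3\<close>) to the wedge product with
  \<open>\<omega>\<^sub>D\<close>, \<open>\<omega>\<^sub>1\<close>, \<open>\<omega>\<^sub>2\<close> and transposes to adjoints. For \<open>n = 1\<close> these are the matrices of the six
  operators on the even forms in the orthonormal basis \<open>1, \<omega>\<^sub>D, \<omega>\<^sub>1, \<omega>\<^sub>2\<close>. As the six operators generate,
  an isomorphism with these values is unique.
\<close>

definition matrix_unit :: "4 \<Rightarrow> 4 \<Rightarrow> real^4^4" where
  "matrix_unit i j = (\<chi> a b. if a = i \<and> b = j then 1 else 0)"

text \<open>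
  An isomorphism of Lie algebras from \<open>sl(4,\<real>)\<close> onto an algebra \<open>\<LL>\<close> of bundle operators which is
  an action on the bundle by fibrewise linear maps.
\<close>

definition sl4_isomorphism ::
    "(real^4^4 \<Rightarrow> ('x, 'e::euclidean_space) bundle_op) \<Rightarrow> ('x, 'e) bundle_op set \<Rightarrow> bool" where
  "sl4_isomorphism \<rho> \<LL> \<longleftrightarrow>
     bij_betw \<rho> sl4 \<LL>
     \<and> (\<forall>M\<in>sl4. \<forall>p. linear (\<rho> M p))
     \<and> (\<forall>M\<in>sl4. \<forall>N\<in>sl4. \<rho> (M + N) = op_add (\<rho> M) (\<rho> N))
     \<and> (\<forall>r. \<forall>M\<in>sl4. \<rho> (r *\<^sub>R M) = op_scale r (\<rho> M))
     \<and> (\<forall>M\<in>sl4. \<forall>N\<in>sl4. \<rho> (M ** N - N ** M) = op_commutator (\<rho> M) (\<rho> N))"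

end

theory Submission
  imports Defs
begin

text \<open>
  In an orthonormal standard basis \<open>e\<^sub>1, \<dots>, e\<^sub>3\<^sub>n\<close> of a tangent space, the operators \<open>e\<^sub>k\<^sup>* \<and> _\<close> and
  \<open>\<iota>(e\<^sub>k)\<close> are mutually adjoint and satisfy the canonical anticommutation relations. Each \<open>L\<^sub>i\<close> is a
  sum of \<open>n\<close> products of two operators of the first kind, and \<open>L\<^sub>i\<^sup>*\<close> is the corresponding sum of
  products of contractions. The \<open>n\<close> triples \<open>(v\<^sub>s, w\<^sup>1\<^sub>s, w\<^sup>2\<^sub>s)\<close> contribute mutually commuting copies, so
  the brackets are those of three fermions:
  \<open>[L\<^sub>i, L\<^sub>j] = 0\<close> and \<open>[[L\<^sub>i, L\<^sub>j\<^sup>*], L\<^sub>k] = \<delta>\<^sub>j\<^sub>k L\<^sub>i + \<delta>\<^sub>i\<^sub>j L\<^sub>k\<close>, with their adjoints. These are the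
  relations between the matrix units \<open>E\<^sub>i\<^sub>+\<^sub>1\<^sub>,\<^sub>0\<close> and \<open>E\<^sub>0\<^sub>,\<^sub>i\<^sub>+\<^sub>1\<close>; a double bracket with a matrix unit shows that
  the resulting homomorphism is injective as soon as \<open>L\<^sub>0 \<noteq> 0\<close>.
\<close>

section \<open>Operators with the relations of matrix units\<close>

typedef (overloaded) 'v endo = "{f :: 'v::real_vector \<Rightarrow> 'v. linear f}"
  morphisms endo_apply Endo
  by (rule exI[of _ "\<lambda>x. x"]) (simp add: linear_ident)

setup_lifting type_definition_endo

text \<open>As a type with ring structure, the linear maps become accessible to the general lemmas
  on commutators. The unit comes from \<open>monoid_mult\<close>, not \<open>real_algebra_1\<close>,
  because \<open>0 = 1\<close> holds when the underlying space is trivial.\<close>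

instantiation endo :: (real_vector) "{real_algebra, monoid_mult}"
begin

lift_definition zero_endo :: "'a endo" is "\<lambda>_. 0"
  by (rule linear_zero)

lift_definition one_endo :: "'a endo" is "\<lambda>x. x"
  by (rule linear_ident)

lift_definition plus_endo :: "'a endo \<Rightarrow> 'a endo \<Rightarrow> 'a endo" is "\<lambda>f g x. f x + g x"
  by (rule linear_compose_add)

lift_definition minus_endo :: "'a endo \<Rightarrow> 'a endo \<Rightarrow> 'a endo" is "\<lambda>f g x. f x - g x"
  by (rule linear_compose_sub)

lift_definition uminus_endo :: "'a endo \<Rightarrow> 'a endo" is "\<lambda>f x. - f x"
  by (rule linear_compose_neg)

lift_definition times_endo :: "'a endo \<Rightarrow> 'a endo \<Rightarrow> 'a endo" is "\<lambda>f g x. f (g x)"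
  using linear_compose by (fastforce simp: o_def)

lift_definition scaleR_endo :: "real \<Rightarrow> 'a endo \<Rightarrow> 'a endo" is "\<lambda>r f x. r *\<^sub>R f x"
  by (rule linear_compose_scale_right)

instance
  by standard (transfer; simp add: fun_eq_iff linear_add linear_diff linear_scale algebra_simps)+

end

lemma endo_apply_sum: "endo_apply (\<Sum>i\<in>S. f i) x = (\<Sum>i\<in>S. endo_apply (f i) x)"
  by (induction S rule: infinite_finite_induct)
    (simp_all add: zero_endo.rep_eq plus_endo.rep_eq)

section \<open>Commutator calculus\<close>

definition commutator :: "'a::ring \<Rightarrow> 'a \<Rightarrow> 'a" where
  "commutator x y = x * y - y * x"

lemma commutator_add:
  "commutator (x + y) z = commutator x z + commutator y z"
  "commutator x (y + z) = commutator x y + commutator x z"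
  by (simp_all add: commutator_def algebra_simps)

lemma commutator_zero [simp]: "commutator 0 x = 0" "commutator x 0 = 0" "commutator x x = 0"
  by (simp_all add: commutator_def)

lemma commutator_uminus:
  "commutator (- x) y = - commutator x y" "commutator x (- y) = - commutator x y"
  by (simp_all add: commutator_def)

lemma commutator_diff:
  "commutator (x - y) z = commutator x z - commutator y z"
  "commutator x (y - z) = commutator x y - commutator x z"
  by (simp_all add: commutator_def algebra_simps)

lemma commutator_swap: "commutator x y = - commutator y x"
  by (simp add: commutator_def)

lemma commutator_scaleR:
  fixes x y :: "'a::real_algebra"
  shows "commutator (r *\<^sub>R x) y = r *\<^sub>R commutator x y"
    "commutator x (r *\<^sub>R y) = r *\<^sub>R commutator x y"
  by (simp_all add: commutator_def algebra_simps)

lemma commutator_sum: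
  "commutator (\<Sum>i\<in>S. f i) x = (\<Sum>i\<in>S. commutator (f i) x)"
  "commutator x (\<Sum>i\<in>S. f i) = (\<Sum>i\<in>S. commutator x (f i))"
  by (simp_all add: commutator_def sum_distrib_left sum_distrib_right sum_subtractf)

lemma commutator_jacobi:
  "commutator x (commutator y z) = commutator (commutator x y) z + commutator y (commutator x z)"
  by (simp add: commutator_def algebra_simps)

lemma eq_uminus_imp_zero:
  fixes x :: "'a::real_vector"
  assumes "x = - x"
  shows "x = 0"
proof -
  have "2 *\<^sub>R x = x + x"
    by (rule scaleR_2)
  also have "\<dots> = 0"
    using assms by (metis add.right_inverse)
  finally show ?thesis by simp
qed

text \<open>The elements \<open>l i\<close> and \<open>m i\<close> play the roles of the matrix
  units E_i0 and E_0i. Since [E_i0, E_0j] = E_ij - delta_ij E_00, bracketing once more with E_k0 or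
  E_0k gives the right-hand sides of \<open>lm_l\<close> and \<open>lm_m\<close>.\<close>

locale sl4_generators =
  fixes l m :: "4 \<Rightarrow> 'a::real_algebra"
  assumes l_l: "i \<noteq> 0 \<Longrightarrow> j \<noteq> 0 \<Longrightarrow> commutator (l i) (l j) = 0"
    and m_m: "i \<noteq> 0 \<Longrightarrow> j \<noteq> 0 \<Longrightarrow> commutator (m i) (m j) = 0"
    and lm_l: "i \<noteq> 0 \<Longrightarrow> j \<noteq> 0 \<Longrightarrow> k \<noteq> 0 \<Longrightarrow>
      commutator (commutator (l i) (m j)) (l k)
      = (if j = k then l i else 0) + (if i = j then l k else 0)"
    and lm_m: "i \<noteq> 0 \<Longrightarrow> j \<noteq> 0 \<Longrightarrow> k \<noteq> 0 \<Longrightarrow>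
      commutator (commutator (l i) (m j)) (m k)
      = - (if i = k then m j else 0) - (if i = j then m k else 0)"
begin

text \<open>
  The homomorphism is extended to all of \<open>gl(4)\<close> by letting the identity act as \<open>0\<close>, so that the
  commutators of all 16 matrix units have a uniform expression. Then \<open>matrix_unit 0 0\<close> acts like
  its projection \<open>- 1/4 (\<Sum>i\<noteq>0. E\<^sub>i\<^sub>i - E\<^sub>0\<^sub>0)\<close> to \<open>sl(4)\<close>.
\<close>

definition unit00 :: 'a where
  "unit00 = - ((1/4) *\<^sub>R (\<Sum>i\<in>-{0}. commutator (l i) (m i)))"

definition unit_op :: "4 \<Rightarrow> 4 \<Rightarrow> 'a" where
  "unit_op i j =
     (if i = 0 then (if j = 0 then unit00 else m j)
      else if j = 0 then l i else commutator (l i) (m j) + (if i = j then unit00 else 0))"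

definition rep :: "real^4^4 \<Rightarrow> 'a" where
  "rep M = (\<Sum>i\<in>UNIV. \<Sum>j\<in>UNIV. M $ i $ j *\<^sub>R unit_op i j)"

lemma card_nonzero_4: "card (- {0::4}) = 3"
  by (simp add: card_Diff_singleton Compl_eq_Diff_UNIV)

lemma unit00_l:
  assumes "k \<noteq> 0"
  shows "commutator unit00 (l k) = - l k"
proof -
  have "(\<Sum>i\<in>-{0}. commutator (commutator (l i) (m i)) (l k)) = (\<Sum>i\<in>-{0}. (if i = k then l i else 0) + l k)"
    by (rule sum.cong) (use assms in \<open>auto simp: lm_l\<close>)
  \<comment> \<open>Three copies of \<open>l k\<close> come from the constant summand and one from
    the index \<open>i = k\<close>; this total of 4 cancels the factor 1/4 in
    \<open>unit00\<close>.\<close>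
  also have "\<dots> = 4 *\<^sub>R l k"
    using assms scaleR_add_left[of 1 3 "l k"]
    by (simp add: sum.distrib sum.delta card_nonzero_4 sum_constant_scaleR)
  finally show ?thesis
    by (simp add: unit00_def commutator_uminus commutator_scaleR commutator_sum)
qed

lemma unit00_m:
  assumes "k \<noteq> 0"
  shows "commutator unit00 (m k) = m k"
proof -
  have "(\<Sum>i\<in>-{0}. commutator (commutator (l i) (m i)) (m k))
      = (\<Sum>i\<in>-{0}. - ((if i = k then m i else 0) + m k))"
    by (rule sum.cong) (use assms in \<open>auto simp: lm_m\<close>)
  also have "\<dots> = - (4 *\<^sub>R m k)"
    unfolding sum_negf
    using assms scaleR_add_left[of 1 3 "m k"]
    by (simp add: sum.distrib sum.delta card_nonzero_4 sum_constant_scaleR)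
  finally show ?thesis
    by (simp add: unit00_def commutator_uminus commutator_scaleR commutator_sum)
qed

text \<open>The bracket with \<open>unit00\<close> is a derivation under which \<open>l i\<close>
  has weight -1 and \<open>m j\<close> has weight 1, so the weights cancel.\<close>

lemma unit00_lm:
  assumes "i \<noteq> 0" "j \<noteq> 0"
  shows "commutator unit00 (commutator (l i) (m j)) = 0"
  unfolding commutator_jacobi[of unit00]
  using assms by (simp add: unit00_l unit00_m commutator_uminus)

lemma unit_op_simps:
  "unit_op 0 0 = unit00"
  "i \<noteq> 0 \<Longrightarrow> unit_op i 0 = l i"
  "i \<noteq> 0 \<Longrightarrow> unit_op 0 i = m i"
  by (simp_all add: unit_op_def)

lemma lm_eq_unit_op:
  assumes "i \<noteq> 0" "j \<noteq> 0"
  shows "commutator (l i) (m j) = unit_op i j - (if i = j then unit00 else 0)"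
  using assms by (simp add: unit_op_def)

lemma unit_op_l:
  assumes "i \<noteq> 0" "j \<noteq> 0" "k \<noteq> 0"
  shows "commutator (unit_op i j) (l k) = (if j = k then l i else 0)"
  using assms by (simp add: unit_op_def commutator_add lm_l unit00_l)

lemma unit_op_m:
  assumes "i \<noteq> 0" "j \<noteq> 0" "k \<noteq> 0"
  shows "commutator (unit_op i j) (m k) = - (if i = k then m j else 0)"
  using assms by (simp add: unit_op_def commutator_add lm_m unit00_m)

lemma unit00_unit_op:
  assumes "i \<noteq> 0" "j \<noteq> 0"
  shows "commutator unit00 (unit_op i j) = 0"
  using assms by (simp add: unit_op_def commutator_add unit00_lm)

text \<open>Up to a multiple of \<open>unit00\<close>, which commutes with
  \<open>unit_op i j\<close>, the second unit is the bracket of \<open>l k\<close> and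
  \<open>m r\<close>. Jacobi then reduces everything to the known action on \<open>l\<close> and
  \<open>m\<close>.\<close>

lemma unit_op_unit_op:
  assumes "i \<noteq> 0" "j \<noteq> 0" "k \<noteq> 0" "r \<noteq> 0"
  shows "commutator (unit_op i j) (unit_op k r)
    = (if j = k then unit_op i r else 0) - (if i = r then unit_op k j else 0)"
proof -
  have "commutator (unit_op i j) (unit_op k r)
      = commutator (unit_op i j) (commutator (l k) (m r))
        - (if k = r then commutator unit00 (unit_op i j) else 0)"
    using assms by (simp add: lm_eq_unit_op commutator_diff commutator_swap[of "unit_op i j" unit00])
  also have "\<dots> = commutator (unit_op i j) (commutator (l k) (m r))"
    using assms by (simp add: unit00_unit_op)
  also have "\<dots> = (if j = k then commutator (l i) (m r) else 0)
      - (if i = r then commutator (l k) (m j) else 0)"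
    unfolding commutator_jacobi[of "unit_op i j"]
    using assms by (simp add: unit_op_l unit_op_m commutator_uminus)
  \<comment> \<open>Rewriting the brackets as units produces \<open>unit00\<close> only when both
    \<open>j = k\<close> and \<open>i = r\<close>, and then its two occurrences cancel.\<close>
  also have "\<dots> = (if j = k then unit_op i r else 0) - (if i = r then unit_op k j else 0)"
    using assms by (simp add: lm_eq_unit_op)
  finally show ?thesis .
qed

lemma commutator_unit_op:
  "commutator (unit_op i j) (unit_op k r)
   = (if j = k then unit_op i r else 0) - (if i = r then unit_op k j else 0)"
proof -
  \<comment> \<open>Splitting on which of the four indices vanish leaves brackets that are known
    only in one order; these rules turn them into that order.\<close>
  have swap:
    "commutator (l a) (unit_op b c) = - commutator (unit_op b c) (l a)"
    "commutator (m a) (unit_op b c) = - commutator (unit_op b c) (m a)"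
    "commutator (unit_op b c) unit00 = - commutator unit00 (unit_op b c)"
    "commutator (l a) unit00 = - commutator unit00 (l a)"
    "commutator (m a) unit00 = - commutator unit00 (m a)"
    "commutator (m a) (l b) = - commutator (l b) (m a)" for a b c
    by (rule commutator_swap)+
  show ?thesis
    by (cases "i = 0"; cases "j = 0"; cases "k = 0"; cases "r = 0")
      (simp_all add: unit_op_simps unit_op_l unit_op_m unit00_l unit00_m unit00_unit_op
        unit_op_unit_op lm_eq_unit_op l_l m_m swap)
qed

section \<open>The homomorphism defined on matrices\<close>

lemma rep_linear: "linear rep"
  unfolding rep_def
  by (intro linear_compose_sum ballI linearI) (simp_all add: algebra_simps)

lemma rep_matrix_unit: "rep (matrix_unit i j) = unit_op i j"
proof -
  have "rep (matrix_unit i j) = (\<Sum>a\<in>UNIV. \<Sum>b\<in>UNIV. if a = i then (if b = j then unit_op a b else 0) else 0)"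
    unfolding rep_def matrix_unit_def by (intro sum.cong) simp_all
  also have "\<dots> = (\<Sum>a\<in>UNIV. if a = i then unit_op a j else 0)"
    by (intro sum.cong) simp_all
  finally show ?thesis by simp
qed

text \<open>Bilinear expansion gives a fourfold sum over brackets of units. The two Kronecker deltas
  in \<open>commutator_unit_op\<close> contract it to the entries of \<open>M ** N\<close> and of
  \<open>N ** M\<close>.\<close>

lemma rep_commutator: "rep (M ** N - N ** M) = commutator (rep M) (rep N)"
proof -
  let ?t = unit_op
  have rep_mult: "rep (M ** N) = (\<Sum>i\<in>UNIV. \<Sum>j\<in>UNIV. \<Sum>k\<in>UNIV. (M $ i $ j * N $ j $ k) *\<^sub>R ?t i k)"
    for M N :: "real^4^4"
    unfolding rep_def
    by (rule sum.cong[OF refl], simp add: matrix_matrix_mult_def scaleR_sum_left, rule sum.swap)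
  have "commutator (rep M) (rep N)
      = (\<Sum>i\<in>UNIV. \<Sum>j\<in>UNIV. \<Sum>k\<in>UNIV. \<Sum>r\<in>UNIV. (M $ i $ j * N $ k $ r) *\<^sub>R commutator (?t i j) (?t k r))"
  proof -
    have L: "commutator (rep M) X = (\<Sum>i\<in>UNIV. \<Sum>j\<in>UNIV. M $ i $ j *\<^sub>R commutator (?t i j) X)" for X
      by (simp add: rep_def commutator_sum commutator_scaleR)
    have R: "commutator X (rep N) = (\<Sum>k\<in>UNIV. \<Sum>r\<in>UNIV. N $ k $ r *\<^sub>R commutator X (?t k r))" for X
      by (simp add: rep_def commutator_sum commutator_scaleR)
    show ?thesis
      unfolding L[of "rep N"] unfolding R by (simp only: scaleR_sum_right scaleR_scaleR)
  qed
  also have "\<dots> = (\<Sum>i\<in>UNIV. \<Sum>j\<in>UNIV. \<Sum>k\<in>UNIV. \<Sum>r\<in>UNIV.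
        (if j = k then (M $ i $ j * N $ k $ r) *\<^sub>R ?t i r else 0))
      - (\<Sum>i\<in>UNIV. \<Sum>j\<in>UNIV. \<Sum>k\<in>UNIV. \<Sum>r\<in>UNIV.
        (if i = r then (N $ k $ r * M $ i $ j) *\<^sub>R ?t k j else 0))"
    unfolding sum_subtractf[symmetric]
    by (intro sum.cong refl) (simp add: commutator_unit_op scaleR_diff_right mult.commute)
  also have "(\<Sum>i\<in>UNIV. \<Sum>j\<in>UNIV. \<Sum>k\<in>UNIV. \<Sum>r\<in>UNIV.
        (if j = k then (M $ i $ j * N $ k $ r) *\<^sub>R ?t i r else 0)) = rep (M ** N)"
  proof -
    have "(\<Sum>k\<in>UNIV. \<Sum>r\<in>UNIV. (if j = k then (M $ i $ j * N $ k $ r) *\<^sub>R ?t i r else 0))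
        = (\<Sum>k\<in>UNIV. if j = k then \<Sum>r\<in>UNIV. (M $ i $ j * N $ k $ r) *\<^sub>R ?t i r else 0)" for i j
      by (intro sum.cong) auto
    then show ?thesis
      unfolding rep_mult by simp
  qed
  also have "(\<Sum>i\<in>UNIV. \<Sum>j\<in>UNIV. \<Sum>k\<in>UNIV. \<Sum>r\<in>UNIV.
        (if i = r then (N $ k $ r * M $ i $ j) *\<^sub>R ?t k j else 0))
      = (\<Sum>i\<in>UNIV. \<Sum>j\<in>UNIV. \<Sum>k\<in>UNIV. (N $ k $ i * M $ i $ j) *\<^sub>R ?t k j)"
    by simp
  also have "\<dots> = (\<Sum>i\<in>UNIV. \<Sum>k\<in>UNIV. \<Sum>j\<in>UNIV. (N $ k $ i * M $ i $ j) *\<^sub>R ?t k j)"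
    by (intro sum.cong refl sum.swap)
  also have "\<dots> = rep (N ** M)"
    unfolding rep_mult by (rule sum.swap)
  finally show ?thesis
    by (simp add: linear_diff[OF rep_linear])
qed

text \<open>The total coefficient of \<open>unit00\<close> in \<open>rep M\<close> is the trace of
  \<open>M\<close>, so it drops out. What remains uses only the generators and their first brackets,
  which places the image of sl(4) inside the generated Lie algebra.\<close>

lemma rep_sl4:
  assumes "trace M = 0"
  shows "rep M = (\<Sum>i\<in>-{0}. M $ i $ 0 *\<^sub>R l i) + (\<Sum>i\<in>-{0}. M $ 0 $ i *\<^sub>R m i)
    + (\<Sum>i\<in>-{0}. \<Sum>j\<in>-{0}. M $ i $ j *\<^sub>R commutator (l i) (m j))"
proof -
  have split: "(\<Sum>i\<in>UNIV. f i) = f 0 + (\<Sum>i\<in>-{0}. f i)" for f :: "4 \<Rightarrow> 'b::comm_monoid_add"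
    using sum.remove[of UNIV 0 f] by (simp add: Compl_eq_Diff_UNIV)
  have tr: "M $ 0 $ 0 = - (\<Sum>i\<in>-{0}. M $ i $ i)"
    using assms by (simp add: trace_def split)
  have "(\<Sum>i\<in>-{0}. \<Sum>j\<in>-{0}. M $ i $ j *\<^sub>R unit_op i j)
      = (\<Sum>i\<in>-{0}. \<Sum>j\<in>-{0}. M $ i $ j *\<^sub>R commutator (l i) (m j)
          + (if i = j then M $ i $ j *\<^sub>R unit00 else 0))"
    by (intro sum.cong refl) (simp add: unit_op_def scaleR_add_right)
  also have "\<dots> = (\<Sum>i\<in>-{0}. \<Sum>j\<in>-{0}. M $ i $ j *\<^sub>R commutator (l i) (m j))
      + (\<Sum>i\<in>-{0}. M $ i $ i *\<^sub>R unit00)"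
    by (simp add: sum.distrib)
  also have "(\<Sum>i\<in>-{0}. M $ i $ i *\<^sub>R unit00) = - (M $ 0 $ 0 *\<^sub>R unit00)"
    by (simp add: tr scaleR_sum_left)
  finally show ?thesis
    unfolding rep_def split by (simp add: unit_op_simps sum.distrib)
qed

text \<open>This is the argument for the simplicity of sl(4): if one off-diagonal unit vanished,
  brackets would kill the other off-diagonal units in row \<open>a\<close> and column
  \<open>a\<close>, and through these also \<open>unit_op 1 0\<close>, which is
  \<open>l 1\<close>.\<close>

lemma unit_op_nonzero:
  assumes "l 1 \<noteq> 0" "a \<noteq> b"
  shows "unit_op a b \<noteq> 0"
proof
  assume ab: "unit_op a b = 0"
  have row: "unit_op a c = 0" if "c \<noteq> a" for c
  proof (cases "c = b")
    case False
    have "unit_op a c = commutator (unit_op a b) (unit_op b c)"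
      using that by (simp add: commutator_unit_op)
    then show ?thesis by (simp add: ab)
  qed (simp add: ab)
  have diag: "unit_op a a = unit_op b b"
    using commutator_unit_op[of a b b a] by (simp add: ab)
  have col: "unit_op c a = 0" if "c \<noteq> a" for c
  proof (cases "c = b")
    case False
    have "unit_op c a = commutator (unit_op c a) (unit_op a a)"
      using that by (simp add: commutator_unit_op)
    also have "\<dots> = 0"
      using that False assms(2) by (simp add: diag commutator_unit_op)
    finally show ?thesis .
  next
    case True
    \<comment> \<open>The bracket of E_ba with E_aa is E_ba, and with E_bb it is -E_ba; as
      \<open>diag\<close> identifies the images of E_aa and E_bb, the image of E_ba equals its own
      negative.\<close>
    have "unit_op b a = commutator (unit_op b a) (unit_op a a)"
      using assms(2) by (simp add: commutator_unit_op)
    also have "\<dots> = - unit_op b a"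
      using assms(2) by (simp add: diag commutator_unit_op)
    finally show ?thesis
      using True by (simp add: eq_uminus_imp_zero)
  qed
  have "unit_op 1 0 = 0"
  proof (cases "a = 1 \<or> a = 0")
    case True
    then show ?thesis using row[of 0] col[of 1] by auto
  next
    case False
    have "unit_op 1 0 = commutator (unit_op 1 a) (unit_op a 0)"
      by (simp add: commutator_unit_op)
    then show ?thesis using False col[of 1] by auto
  qed
  then show False
    using assms(1) by (simp add: unit_op_simps)
qed

text \<open>
  Off-diagonal entries are isolated by a double bracket with \<open>E = matrix_unit a b\<close>: since
  \<open>E\<^sup>2 = 0\<close>, it maps \<open>M\<close> to \<open>- 2 E M E\<close>.
\<close>

lemma rep_eq_0_imp:
  assumes "l 1 \<noteq> 0" "trace M = 0" "rep M = 0"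
  shows "M = 0"
proof -
  let ?t = unit_op
  have br: "commutator (?t a b) (rep M)
      = (\<Sum>r\<in>UNIV. M $ b $ r *\<^sub>R ?t a r) - (\<Sum>k\<in>UNIV. M $ k $ a *\<^sub>R ?t k b)" for a b
  proof -
    have "commutator (?t a b) (rep M)
        = (\<Sum>k\<in>UNIV. \<Sum>r\<in>UNIV. (if b = k then M $ k $ r *\<^sub>R ?t a r else 0))
          - (\<Sum>k\<in>UNIV. \<Sum>r\<in>UNIV. (if a = r then M $ k $ r *\<^sub>R ?t k b else 0))"
      unfolding rep_def sum_subtractf[symmetric] commutator_sum
      by (intro sum.cong refl) (simp add: commutator_unit_op commutator_scaleR scaleR_diff_right)
    also have "(\<Sum>k\<in>UNIV. \<Sum>r\<in>UNIV. (if b = k then M $ k $ r *\<^sub>R ?t a r else 0))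
        = (\<Sum>k\<in>UNIV. if b = k then \<Sum>r\<in>UNIV. M $ k $ r *\<^sub>R ?t a r else 0)"
      by (intro sum.cong) auto
    finally show ?thesis by simp
  qed
  have off: "M $ b $ a = 0" if "a \<noteq> b" for a b
  proof -
    have "0 = commutator (?t a b) (commutator (?t a b) (rep M))"
      by (simp add: assms(3))
    also have "\<dots> = (\<Sum>r\<in>UNIV. M $ b $ r *\<^sub>R commutator (?t a b) (?t a r))
        - (\<Sum>k\<in>UNIV. M $ k $ a *\<^sub>R commutator (?t a b) (?t k b))"
      unfolding br by (simp add: commutator_diff commutator_sum commutator_scaleR)
    also have "(\<Sum>r\<in>UNIV. M $ b $ r *\<^sub>R commutator (?t a b) (?t a r))
        = (\<Sum>r\<in>UNIV. if r = a then - (M $ b $ a *\<^sub>R ?t a b) else 0)"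
      using that by (intro sum.cong refl) (auto simp: commutator_unit_op)
    also have "(\<Sum>k\<in>UNIV. M $ k $ a *\<^sub>R commutator (?t a b) (?t k b))
        = (\<Sum>k\<in>UNIV. if k = b then M $ b $ a *\<^sub>R ?t a b else 0)"
      using that by (intro sum.cong refl) (auto simp: commutator_unit_op)
    finally have "M $ b $ a *\<^sub>R ?t a b = - (M $ b $ a *\<^sub>R ?t a b)"
      by simp
    then have "M $ b $ a *\<^sub>R ?t a b = 0"
      by (rule eq_uminus_imp_zero)
    then show ?thesis
      using unit_op_nonzero[OF assms(1) that] by simp
  qed
  \<comment> \<open>Now that \<open>M\<close> is diagonal, its bracket with E_a0 is a multiple of
    E_a0 whose coefficient is the difference of two diagonal entries.\<close>
  have diag: "M $ a $ a = M $ 0 $ 0" for a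
  proof (cases "a = 0")
    case False
    have "(\<Sum>r\<in>UNIV. M $ 0 $ r *\<^sub>R ?t a r) = (\<Sum>r\<in>(UNIV::4 set). if r = 0 then M $ 0 $ 0 *\<^sub>R ?t a 0 else 0)"
      by (rule sum.cong) (auto simp: off)
    moreover have "(\<Sum>k\<in>UNIV. M $ k $ a *\<^sub>R ?t k 0) = (\<Sum>k\<in>UNIV. if k = a then M $ a $ a *\<^sub>R ?t a 0 else 0)"
      by (rule sum.cong) (auto simp: off)
    ultimately have "(M $ 0 $ 0 - M $ a $ a) *\<^sub>R ?t a 0 = 0"
      using br[of a 0] by (simp add: assms(3) scaleR_diff_left)
    then show ?thesis
      using unit_op_nonzero[OF assms(1) False] by simp
  qed simp
  have "trace M = (\<Sum>a\<in>(UNIV::4 set). M $ 0 $ 0)"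
    unfolding trace_def by (rule sum.cong[OF refl diag])
  then have "M $ 0 $ 0 = 0"
    using assms(2) by simp
  then show ?thesis
    using off diag unfolding vec_eq_iff zero_index by metis
qed

end

section \<open>Fermions\<close>

text \<open>The anticommutation relations are oriented as rewrite rules towards normal order:
  creators \<open>c\<close> to the left of annihilators \<open>a\<close>, each kind with increasing
  indices. Every required identity is then verified by comparing normal forms.\<close>

lemma sl4_generators_three_fermions:
  fixes c0 c1 c2 a0 a1 a2 :: "'a::{real_algebra, monoid_mult}"
  defines "l \<equiv> \<lambda>i::4. if i = 1 then c1 * c2 else if i = 2 then c0 * c1 else c0 * c2"
    and "m \<equiv> \<lambda>i::4. if i = 1 then a2 * a1 else if i = 2 then a1 * a0 else a2 * a0"
  assumes sq: "c0 * c0 = 0" "c1 * c1 = 0" "c2 * c2 = 0" "a0 * a0 = 0" "a1 * a1 = 0" "a2 * a2 = 0"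
    and cc: "c1 * c0 = - (c0 * c1)" "c2 * c0 = - (c0 * c2)" "c2 * c1 = - (c1 * c2)"
    and aa: "a1 * a0 = - (a0 * a1)" "a2 * a0 = - (a0 * a2)" "a2 * a1 = - (a1 * a2)"
    and ac: "a0 * c0 = 1 - c0 * a0" "a1 * c1 = 1 - c1 * a1" "a2 * c2 = 1 - c2 * a2"
      "a0 * c1 = - (c1 * a0)" "a0 * c2 = - (c2 * a0)" "a1 * c0 = - (c0 * a1)"
      "a1 * c2 = - (c2 * a1)" "a2 * c0 = - (c0 * a2)" "a2 * c1 = - (c1 * a2)"
  shows "sl4_generators l m"
proof -
  note rules = sq cc aa ac
  have assoc: "x * (y * z) = w * z" if "x * y = w" for x y z w :: 'a
    using that by (simp flip: mult.assoc)
  \<comment> \<open>Products are nested to the right, so each rule also needs a version that acts on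
    the first two factors of a longer product.\<close>
  note rules2 = rules[THEN assoc]
  have nz: "i = 1 \<or> i = 2 \<or> i = 3" if "i \<noteq> 0" for i :: 4
    using that exhaust_4[of i] by auto
  note S = l_def m_def commutator_def algebra_simps rules rules2
  show ?thesis
  proof
    fix i j :: 4 assume "i \<noteq> 0" "j \<noteq> 0"
    then show "commutator (l i) (l j) = 0" "commutator (m i) (m j) = 0"
      by (auto dest!: nz simp: S)
  next
    fix i j k :: 4 assume "i \<noteq> 0" "j \<noteq> 0" "k \<noteq> 0"
    then show "commutator (commutator (l i) (m j)) (l k)
        = (if j = k then l i else 0) + (if i = j then l k else 0)"
      "commutator (commutator (l i) (m j)) (m k)
        = - (if i = k then m j else 0) - (if i = j then m k else 0)"
      by (auto dest!: nz simp: S)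
  qed
qed


section \<open>Sums of commuting copies\<close>

lemma commutator_sum_diagonal:
  assumes "finite S" "\<And>s t. s \<in> S \<Longrightarrow> t \<in> S \<Longrightarrow> s \<noteq> t \<Longrightarrow> commutator (x s) (y t) = 0"
  shows "commutator (\<Sum>s\<in>S. x s) (\<Sum>s\<in>S. y s) = (\<Sum>s\<in>S. commutator (x s) (y s))"
proof -
  have "commutator (\<Sum>s\<in>S. x s) (\<Sum>s\<in>S. y s) = (\<Sum>s\<in>S. \<Sum>t\<in>S. commutator (x s) (y t))"
    unfolding commutator_sum(1) unfolding commutator_sum(2) ..
  also have "\<dots> = (\<Sum>s\<in>S. \<Sum>t\<in>S. if s = t then commutator (x s) (y t) else 0)"
    by (intro sum.cong refl) (simp add: assms(2))
  finally show ?thesis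
    using assms(1) by simp
qed

text \<open>By Jacobi the bracket with \<open>z\<close> is a derivation, so the centralizer of
  \<open>z\<close> is closed under brackets.\<close>

lemma commutator_commutator_eq_0:
  assumes "commutator x z = 0" "commutator y z = 0"
  shows "commutator (commutator x y) z = 0"
  using commutator_jacobi[of z x y] assms
  by (simp add: commutator_swap[of z] commutator_uminus)

text \<open>Brackets between different copies vanish, so single and double brackets of the sums are
  computed copy by copy. The relations survive the summation because their right-hand sides are
  linear in the generators.\<close>

lemma sl4_generators_sum:
  fixes l m :: "'s \<Rightarrow> 4 \<Rightarrow> 'a::real_algebra"
  assumes S: "finite S" "\<And>s. s \<in> S \<Longrightarrow> sl4_generators (l s) (m s)"
    and comm: "\<And>s t i j. s \<in> S \<Longrightarrow> t \<in> S \<Longrightarrow> s \<noteq> t \<Longrightarrow> commutator (l s i) (l t j) = 0"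
      "\<And>s t i j. s \<in> S \<Longrightarrow> t \<in> S \<Longrightarrow> s \<noteq> t \<Longrightarrow> commutator (m s i) (m t j) = 0"
      "\<And>s t i j. s \<in> S \<Longrightarrow> t \<in> S \<Longrightarrow> s \<noteq> t \<Longrightarrow> commutator (l s i) (m t j) = 0"
  shows "sl4_generators (\<lambda>i. \<Sum>s\<in>S. l s i) (\<lambda>i. \<Sum>s\<in>S. m s i)"
proof
  note diag = commutator_sum_diagonal[OF S(1)]
  have ml: "commutator (m s i) (l t j) = 0" if "s \<in> S" "t \<in> S" "s \<noteq> t" for s t i j
    using comm(3)[of t s j i] that by (simp add: commutator_swap[of "m s i"])
  fix i j :: 4 assume ij: "i \<noteq> 0" "j \<noteq> 0"
  show "commutator (\<Sum>s\<in>S. l s i) (\<Sum>s\<in>S. l s j) = 0"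
    by (subst diag) (auto simp: comm(1) sl4_generators.l_l[OF S(2)] ij)
  show "commutator (\<Sum>s\<in>S. m s i) (\<Sum>s\<in>S. m s j) = 0"
    by (subst diag) (auto simp: comm(2) sl4_generators.m_m[OF S(2)] ij)
  have lm: "commutator (\<Sum>s\<in>S. l s i) (\<Sum>s\<in>S. m s j) = (\<Sum>s\<in>S. commutator (l s i) (m s j))"
    by (rule diag) (rule comm(3))
  fix k :: 4 assume k: "k \<noteq> 0"
  have "commutator (commutator (\<Sum>s\<in>S. l s i) (\<Sum>s\<in>S. m s j)) (\<Sum>s\<in>S. l s k)
      = (\<Sum>s\<in>S. commutator (commutator (l s i) (m s j)) (l s k))"
    unfolding lm by (rule diag) (simp add: commutator_commutator_eq_0 comm(1) ml)
  also have "\<dots> = (\<Sum>s\<in>S. (if j = k then l s i else 0) + (if i = j then l s k else 0))"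
    by (intro sum.cong refl) (simp add: sl4_generators.lm_l[OF S(2)] ij k)
  finally show "commutator (commutator (\<Sum>s\<in>S. l s i) (\<Sum>s\<in>S. m s j)) (\<Sum>s\<in>S. l s k)
      = (if j = k then \<Sum>s\<in>S. l s i else 0) + (if i = j then \<Sum>s\<in>S. l s k else 0)"
    by (simp add: sum.distrib)
  have "commutator (commutator (\<Sum>s\<in>S. l s i) (\<Sum>s\<in>S. m s j)) (\<Sum>s\<in>S. m s k)
      = (\<Sum>s\<in>S. commutator (commutator (l s i) (m s j)) (m s k))"
    unfolding lm by (rule diag) (simp add: commutator_commutator_eq_0 comm(2,3))
  also have "\<dots> = (\<Sum>s\<in>S. - (if i = k then m s j else 0) - (if i = j then m s k else 0))"
    by (intro sum.cong refl) (simp add: sl4_generators.lm_m[OF S(2)] ij k)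
  finally show "commutator (commutator (\<Sum>s\<in>S. l s i) (\<Sum>s\<in>S. m s j)) (\<Sum>s\<in>S. m s k)
      = - (if i = k then \<Sum>s\<in>S. m s j else 0) - (if i = j then \<Sum>s\<in>S. m s k else 0)"
    by (auto simp: sum_subtractf sum_negf)
qed

text \<open>Moving a pair past a pair costs four sign changes.\<close>

lemma commutator_pairs_eq_0:
  assumes "x * z = - (z * x)" "x * w = - (w * x)" "y * z = - (z * y)" "y * w = - (w * y)"
  shows "commutator (x * y) (z * w) = 0"
proof -
  have "x * y * (z * w) = x * (y * z) * w"
    by (simp add: mult.assoc)
  also have "\<dots> = - ((x * z) * (y * w))"
    by (simp add: assms(3) mult.assoc)
  also have "\<dots> = - (z * (x * w) * y)"
    by (simp add: assms(1,4) mult.assoc)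
  also have "\<dots> = z * w * (x * y)"
    by (simp add: assms(2) mult.assoc)
  finally show ?thesis
    by (simp add: commutator_def)
qed

text \<open>Modes are numbered like the concatenated basis list: \<open>s\<close> belongs to v_s,
  \<open>n + s\<close> to w^1_s and \<open>n + n + s\<close> to w^2_s. Thus the indices 1, 2, 3 give
  the summands number \<open>s\<close> of the dualizing form and of the two given forms.\<close>

definition fermion_l :: "nat \<Rightarrow> (nat \<Rightarrow> 'a::{real_algebra, monoid_mult}) \<Rightarrow> nat \<Rightarrow> 4 \<Rightarrow> 'a" where
  "fermion_l n c s i =
     (if i = 1 then c (n + s) * c (n + n + s) else if i = 2 then c s * c (n + s) else c s * c (n + n + s))"

text \<open>The factors stand in the opposite order to those of \<open>fermion_l\<close>, as taking
  adjoints reverses products.\<close>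

definition fermion_m :: "nat \<Rightarrow> (nat \<Rightarrow> 'a::{real_algebra, monoid_mult}) \<Rightarrow> nat \<Rightarrow> 4 \<Rightarrow> 'a" where
  "fermion_m n a s i =
     (if i = 1 then a (n + n + s) * a (n + s) else if i = 2 then a (n + s) * a s else a (n + n + s) * a s)"

lemma sl4_generators_fermion:
  fixes c a :: "nat \<Rightarrow> 'a::{real_algebra, monoid_mult}"
  assumes cc: "\<And>j k. j < n + n + n \<Longrightarrow> k < n + n + n \<Longrightarrow> c j * c k = - (c k * c j)"
    and aa: "\<And>j k. j < n + n + n \<Longrightarrow> k < n + n + n \<Longrightarrow> a j * a k = - (a k * a j)"
    and ac: "\<And>j k. j < n + n + n \<Longrightarrow> k < n + n + n \<Longrightarrow>
      a j * c k = (if j = k then 1 else 0) - c k * a j"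
  shows "sl4_generators (\<lambda>i. \<Sum>s<n. fermion_l n c s i) (\<lambda>i. \<Sum>s<n. fermion_m n a s i)"
proof (rule sl4_generators_sum)
  have csq: "c k * c k = 0" and asq: "a k * a k = 0" if "k < n + n + n" for k
    using eq_uminus_imp_zero[OF cc[OF that that]] eq_uminus_imp_zero[OF aa[OF that that]] .
  have ac_same: "a k * c k = 1 - c k * a k" if "k < n + n + n" for k
    using ac[OF that that] by simp
  have ac_neq: "a j * c k = - (c k * a j)" if "j < n + n + n" "k < n + n + n" "j \<noteq> k" for j k
    using ac[OF that(1,2)] that(3) by simp
  fix s assume "s \<in> {..<n}"
  \<comment> \<open>Positivity of \<open>n\<close> makes the three modes of one copy
    distinct.\<close>
  then have s: "s < n + n + n" "n + s < n + n + n" "n + n + s < n + n + n" "n > 0"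
    by auto
  show "sl4_generators (fermion_l n c s) (fermion_m n a s)"
    unfolding fermion_l_def[abs_def] fermion_m_def[abs_def]
  proof (rule sl4_generators_three_fermions[of "c s" "c (n + s)" "c (n + n + s)" "a s" "a (n + s)" "a (n + n + s)"])
  qed (rule csq asq cc aa ac_same ac_neq s | use s(4) in simp)+
next
  fix s t :: nat and i j :: 4
  assume "s \<in> {..<n}" "t \<in> {..<n}" "s \<noteq> t"
  then have st: "s < n + n + n" "n + s < n + n + n" "n + n + s < n + n + n"
      "t < n + n + n" "n + t < n + n + n" "n + n + t < n + n + n"
    and neq: "s \<noteq> t" "s \<noteq> n + t" "s \<noteq> n + n + t" "n + s \<noteq> t" "n + n + s \<noteq> t"
      "n + s \<noteq> n + n + t" "n + n + s \<noteq> n + t"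
    by auto
  have ca: "c k * a j = - (a j * c k)" if "j < n + n + n" "k < n + n + n" "j \<noteq> k" for j k
    using ac[OF that(1,2)] that(3) by simp
  show "commutator (fermion_l n c s i) (fermion_l n c t j) = 0"
    "commutator (fermion_m n a s i) (fermion_m n a t j) = 0"
    unfolding fermion_l_def fermion_m_def
    by (auto intro!: commutator_pairs_eq_0 cc aa st)
  show "commutator (fermion_l n c s i) (fermion_m n a t j) = 0"
    unfolding fermion_l_def fermion_m_def
    using neq by (auto intro!: commutator_pairs_eq_0 ca st)
qed simp

text \<open>The commutator with \<open>a n\<close> strips one factor from the copy
  \<open>s = 0\<close> and annihilates the other copies. The remaining \<open>c (n + n)\<close>
  cannot vanish, because its anticommutator with \<open>a (n + n)\<close> is 1.\<close>

lemma fermion_l_sum_nonzero: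
  fixes c a :: "nat \<Rightarrow> 'a::{real_algebra, monoid_mult}"
  assumes ac: "\<And>j k. j < n + n + n \<Longrightarrow> k < n + n + n \<Longrightarrow>
      a j * c k = (if j = k then 1 else 0) - c k * a j"
    and "n > 0" "(1::'a) \<noteq> 0"
  shows "(\<Sum>s<n. fermion_l n c s 1) \<noteq> 0"
proof
  assume 0: "(\<Sum>s<n. fermion_l n c s 1) = 0"
  have "commutator (a n) (fermion_l n c s 1) = (if s = 0 then c (n + n) else 0)" if "s < n" for s
  proof -
    have "a n * (c (n + s) * c (n + n + s)) = (a n * c (n + s)) * c (n + n + s)"
      by (simp add: mult.assoc)
    also have "\<dots> = (if s = 0 then c (n + n) else 0) - c (n + s) * (a n * c (n + n + s))"
      using that by (simp add: ac algebra_simps)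
    also have "a n * c (n + n + s) = - (c (n + n + s) * a n)"
      using that by (simp add: ac)
    finally show ?thesis
      by (simp add: commutator_def fermion_l_def mult.assoc)
  qed
  then have "commutator (a n) (\<Sum>s<n. fermion_l n c s 1) = c (n + n)"
    using assms(2) by (simp add: commutator_sum)
  then have "c (n + n) = 0"
    by (simp add: 0)
  then show False
    using ac[of "n + n" "n + n"] assms(2,3) by simp
qed

section \<open>Exterior and interior products\<close>

lemma form_eqI: "(\<And>vs. form_apply \<alpha> vs = form_apply \<beta> vs) \<Longrightarrow> \<alpha> = \<beta>"
  by (simp add: form_apply_inject[symmetric] fun_eq_iff)

lemma linear_form_apply: "linear (\<lambda>v. form_apply \<alpha> (xs @ v # ys))"
  using form_apply[of \<alpha>] by (simp add: alternating_multilinear_def)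

lemma form_apply_not_distinct: "\<not> distinct vs \<Longrightarrow> form_apply \<alpha> vs = 0"
  using form_apply[of \<alpha>] by (simp add: alternating_multilinear_def)

lemma linear_wedge_right: "linear (\<lambda>\<beta>. \<alpha> \<and>\<^sub>F \<beta>)"
  by (rule linearI; rule form_eqI)
    (simp_all add: wedge.rep_eq plus_alt_form.rep_eq scaleR_alt_form.rep_eq wedge_fun_def
      algebra_simps sum.distrib sum_distrib_left)

lemma linear_wedge_left: "linear (\<lambda>\<alpha>. \<alpha> \<and>\<^sub>F \<beta>)"
  by (rule linearI; rule form_eqI)
    (simp_all add: wedge.rep_eq plus_alt_form.rep_eq scaleR_alt_form.rep_eq wedge_fun_def
      algebra_simps sum.distrib sum_distrib_left)

lemma wedge_fun_add_left: "wedge_fun (\<lambda>xs. f xs + g xs) h vs = wedge_fun f h vs + wedge_fun g h vs"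
  by (simp add: wedge_fun_def algebra_simps sum.distrib)

lemma wedge_fun_add_right: "wedge_fun h (\<lambda>xs. f xs + g xs) vs = wedge_fun h f vs + wedge_fun h g vs"
  by (simp add: wedge_fun_def algebra_simps sum.distrib)

lemma wedge_fun_uminus_right: "wedge_fun f (\<lambda>xs. - g xs) vs = - wedge_fun f g vs"
  by (simp add: wedge_fun_def sum_negf)

lemma wedge_fun_scalar_left: "wedge_fun (\<lambda>xs. if xs = [] then r else 0) g vs = r * g vs"
  by (induction vs arbitrary: g)
    (simp_all add: wedge_fun_Nil wedge_fun_Cons wedge_fun_zero if_distrib cong: if_cong)

text \<open>The grading involution is multiplicative for the wedge product; associativity needs this
  to carry the sign of \<open>wedge_fun_Cons\<close> through a product.\<close>

lemma wedge_fun_sign: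
  "wedge_fun (\<lambda>xs. (-1) ^ length xs * f xs) (\<lambda>xs. (-1) ^ length xs * g xs) vs
   = (-1) ^ length vs * wedge_fun f g vs"
proof (induction vs arbitrary: f g)
  case Nil
  show ?case by (simp add: wedge_fun_Nil)
next
  case (Cons v vs)
  have "wedge_fun (\<lambda>xs. (-1) ^ length xs * f xs) (\<lambda>xs. (-1) ^ length xs * g xs) (v # vs)
      = - wedge_fun (\<lambda>xs. (-1) ^ length xs * f (v # xs)) (\<lambda>xs. (-1) ^ length xs * g xs) vs
        - wedge_fun (\<lambda>xs. (-1) ^ length xs * ((-1) ^ length xs * f xs))
            (\<lambda>xs. (-1) ^ length xs * g (v # xs)) vs"
    by (simp add: wedge_fun_Cons wedge_fun_uminus_left wedge_fun_uminus_right)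
  then show ?case
    by (simp only: Cons.IH) (simp add: wedge_fun_Cons algebra_simps)
qed

text \<open>Contraction with the first vector is an antiderivation by \<open>wedge_fun_Cons\<close>,
  so both sides expand into the same three triple products, to which the induction hypothesis
  applies.\<close>

lemma wedge_fun_assoc: "wedge_fun (wedge_fun f g) h vs = wedge_fun f (wedge_fun g h) vs"
proof (induction vs arbitrary: f g h)
  case Nil
  show ?case by (simp add: wedge_fun_Nil)
next
  case (Cons v vs)
  show ?case
    by (simp add: wedge_fun_Cons wedge_fun_add_left wedge_fun_add_right Cons.IH
        flip: wedge_fun_sign)
qed

lemma wedge_assoc: "(\<alpha> \<and>\<^sub>F \<beta>) \<and>\<^sub>F \<gamma> = \<alpha> \<and>\<^sub>F \<beta> \<and>\<^sub>F \<gamma>"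
  by (rule form_eqI) (simp add: wedge.rep_eq wedge_fun_assoc)

lemma covector_form_apply_Nil: "form_apply (covector_form \<theta>) [] = 0"
  by (simp add: covector_form.rep_eq)

text \<open>The antiderivation rule in the case of a left factor of degree 1: its contraction is a
  constant of degree 0 (\<open>const\<close>), and the grading involution negates it
  (\<open>sign\<close>).\<close>

lemma interior_product_covector_wedge:
  "interior_product v (covector_form \<theta> \<and>\<^sub>F \<alpha>)
   = \<theta> v *\<^sub>R \<alpha> - covector_form \<theta> \<and>\<^sub>F interior_product v \<alpha>"
proof (rule form_eqI)
  fix vs
  have const: "(\<lambda>xs. form_apply (covector_form \<theta>) (v # xs)) = (\<lambda>xs. if xs = [] then \<theta> v else 0)"
    by (auto simp: covector_form.rep_eq split: list.splits)
  have sign: "(-1) ^ length xs * form_apply (covector_form \<theta>) xs = - form_apply (covector_form \<theta>) xs" for xs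
    by (auto simp: covector_form.rep_eq split: list.splits)
  show "form_apply (interior_product v (covector_form \<theta> \<and>\<^sub>F \<alpha>)) vs
      = form_apply (\<theta> v *\<^sub>R \<alpha> - covector_form \<theta> \<and>\<^sub>F interior_product v \<alpha>) vs"
    by (simp add: interior_product.rep_eq wedge.rep_eq wedge_fun_Cons const wedge_fun_scalar_left sign
        wedge_fun_uminus_left minus_alt_form.rep_eq scaleR_alt_form.rep_eq)
qed

lemma linear_interior_product_left: "linear (\<lambda>v. interior_product v \<alpha>)"
proof (rule linearI; rule form_eqI)
  fix vs and u v and r :: real
  note L = linear_form_apply[of \<alpha> "[]" vs, simplified]
  show "form_apply (interior_product (u + v) \<alpha>) vs
      = form_apply (interior_product u \<alpha> + interior_product v \<alpha>) vs"
    by (simp add: interior_product.rep_eq plus_alt_form.rep_eq linear_add[OF L])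
  show "form_apply (interior_product (r *\<^sub>R u) \<alpha>) vs = form_apply (r *\<^sub>R interior_product u \<alpha>) vs"
    by (simp add: interior_product.rep_eq scaleR_alt_form.rep_eq linear_scale[OF L])
qed

lemma linear_interior_product_right: "linear (interior_product v)"
  by (rule linearI; rule form_eqI)
    (simp_all add: interior_product.rep_eq plus_alt_form.rep_eq scaleR_alt_form.rep_eq)

lemma interior_product_twice: "interior_product v (interior_product v \<alpha>) = 0"
  by (rule form_eqI) (simp add: interior_product.rep_eq zero_alt_form.rep_eq form_apply_not_distinct)

text \<open>Polarization of \<open>interior_product_twice\<close>.\<close>

lemma interior_product_anticommute:
  "interior_product u (interior_product v \<alpha>) = - interior_product v (interior_product u \<alpha>)"
proof -
  have "interior_product (u + v) (interior_product (u + v) \<alpha>) = 0"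
    by (rule interior_product_twice)
  then have "interior_product u (interior_product v \<alpha>) + interior_product v (interior_product u \<alpha>) = 0"
    by (simp add: linear_add[OF linear_interior_product_left]
        linear_add[OF linear_interior_product_right] interior_product_twice add.commute)
  then show ?thesis
    by (metis eq_neg_iff_add_eq_0 add.commute)
qed

text \<open>Induction on the arguments: contracting with the first one leaves scalar terms that are
  antisymmetric in the two covectors, and a term of the original shape with \<alpha>
  contracted.\<close>

lemma covector_wedge_anticommute:
  "covector_form \<theta> \<and>\<^sub>F covector_form \<eta> \<and>\<^sub>F \<alpha> = - (covector_form \<eta> \<and>\<^sub>F covector_form \<theta> \<and>\<^sub>F \<alpha>)"
proof (rule form_eqI)
  fix vs
  let ?c = covector_form
  show "form_apply (?c \<theta> \<and>\<^sub>F ?c \<eta> \<and>\<^sub>F \<alpha>) vs = form_apply (- (?c \<eta> \<and>\<^sub>F ?c \<theta> \<and>\<^sub>F \<alpha>)) vs"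
  proof (induction vs arbitrary: \<alpha>)
    case Nil
    show ?case
      by (simp add: wedge.rep_eq wedge_fun_Nil covector_form_apply_Nil uminus_alt_form.rep_eq)
  next
    case (Cons v vs)
    have hd: "form_apply \<beta> (v # vs) = form_apply (interior_product v \<beta>) vs" for \<beta>
      by (simp add: interior_product.rep_eq)
    have two: "interior_product v (?c \<theta> \<and>\<^sub>F ?c \<eta> \<and>\<^sub>F \<alpha>)
        = \<theta> v *\<^sub>R (?c \<eta> \<and>\<^sub>F \<alpha>) - \<eta> v *\<^sub>R (?c \<theta> \<and>\<^sub>F \<alpha>)
          + ?c \<theta> \<and>\<^sub>F ?c \<eta> \<and>\<^sub>F interior_product v \<alpha>" for \<theta> \<eta>
      by (simp add: interior_product_covector_wedge linear_diff[OF linear_wedge_right]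
          linear_scale[OF linear_wedge_right])
    show ?case
      unfolding hd linear_neg[OF linear_interior_product_right] two
      using Cons.IH[of "interior_product v \<alpha>"]
      by (simp add: uminus_alt_form.rep_eq plus_alt_form.rep_eq minus_alt_form.rep_eq)
  qed
qed

section \<open>The induced inner product on forms\<close>

definition inner_on :: "'e::euclidean_space list \<Rightarrow> 'e alt_form \<Rightarrow> 'e alt_form \<Rightarrow> real" where
  "inner_on E \<alpha> \<beta> = (\<Sum>I\<in>Pow {..<length E}. form_apply \<alpha> (nths E I) * form_apply \<beta> (nths E I))"

lemma inner_on_Nil: "inner_on [] \<alpha> \<beta> = form_apply \<alpha> [] * form_apply \<beta> []"
  by (simp add: inner_on_def)

text \<open>The index sets are split by whether they contain position 0. For this recursion the list
  has to be a parameter of \<open>inner_on\<close>, since the tail of a basis is no longer a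
  basis.\<close>

lemma inner_on_Cons:
  "inner_on (e # E) \<alpha> \<beta>
   = inner_on E \<alpha> \<beta> + inner_on E (interior_product e \<alpha>) (interior_product e \<beta>)"
proof -
  let ?P = "Pow {..<length E}"
  have P_eq: "Pow {..<length (e # E)} = (`) Suc ` ?P \<union> (\<lambda>J. insert 0 (Suc ` J)) ` ?P"
    by (simp add: lessThan_Suc_eq_insert_0 Pow_insert image_Pow_surj[OF refl, symmetric] image_image)
  have inj1: "inj_on ((`) Suc) ?P"
    by (auto simp: inj_on_def inj_image_eq_iff)
  have inj2: "inj_on (\<lambda>J. insert 0 (Suc ` J)) ?P"
  proof (rule inj_onI)
    fix J K assume "insert 0 (Suc ` J) = insert 0 (Suc ` K)"
    then have "Suc ` J = Suc ` K" by (metis Diff_insert_absorb image_iff nat.distinct(1))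
    then show "J = K" by (simp add: inj_image_eq_iff)
  qed
  show ?thesis
    unfolding inner_on_def P_eq
    by (subst sum.union_disjoint)
      (auto simp: sum.reindex[OF inj1] sum.reindex[OF inj2] nths_Cons_Suc_image
        nths_Cons_insert_0 interior_product.rep_eq)
qed

lemma linear_inner_on_right: "linear (inner_on E \<alpha>)"
  by (rule linearI)
    (simp_all add: inner_on_def plus_alt_form.rep_eq scaleR_alt_form.rep_eq algebra_simps
      sum.distrib sum_distrib_left)

lemma linear_inner_on_left: "linear (\<lambda>\<alpha>. inner_on E \<alpha> \<beta>)"
  by (rule linearI)
    (simp_all add: inner_on_def plus_alt_form.rep_eq scaleR_alt_form.rep_eq algebra_simps
      sum.distrib sum_distrib_left)

text \<open>This identity holds for arbitrary lists, so induction on \<open>E\<close> is possible;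
  orthonormality enters only later, to identify the contracting vector.\<close>

lemma inner_on_covector_wedge:
  "inner_on E (covector_form \<theta> \<and>\<^sub>F \<alpha>) \<beta>
   = inner_on E \<alpha> (interior_product (\<Sum>e\<leftarrow>E. \<theta> e *\<^sub>R e) \<beta>)"
proof (induction E arbitrary: \<alpha> \<beta>)
  case Nil
  show ?case
    by (simp add: inner_on_Nil wedge.rep_eq wedge_fun_Nil covector_form_apply_Nil
        linear_0[OF linear_interior_product_left] zero_alt_form.rep_eq)
next
  case (Cons e E)
  define u where "u = (\<Sum>e\<leftarrow>E. \<theta> e *\<^sub>R e)"
  note ip = linear_add[OF linear_interior_product_left] linear_scale[OF linear_interior_product_left]
    linear_add[OF linear_interior_product_right] linear_scale[OF linear_interior_product_right]
    interior_product_twice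
  note inn = linear_add[OF linear_inner_on_right] linear_scale[OF linear_inner_on_right]
    linear_diff[OF linear_inner_on_left] linear_scale[OF linear_inner_on_left]
    linear_neg[OF linear_inner_on_right]
  have "inner_on (e # E) (covector_form \<theta> \<and>\<^sub>F \<alpha>) \<beta>
      = inner_on E \<alpha> (interior_product u \<beta>) + \<theta> e * inner_on E \<alpha> (interior_product e \<beta>)
        - inner_on E (interior_product e \<alpha>) (interior_product u (interior_product e \<beta>))"
    by (simp add: inner_on_Cons interior_product_covector_wedge inn Cons.IH flip: u_def)
  \<comment> \<open>In the second term the summand along \<open>e\<close> is killed by the double
    contraction with \<open>e\<close>, and swapping the contractions with \<open>e\<close> and
    \<open>u\<close> accounts for the minus sign.\<close>
  also have "\<dots> = inner_on E \<alpha> (interior_product (\<theta> e *\<^sub>R e + u) \<beta>)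
      + inner_on E (interior_product e \<alpha>) (interior_product e (interior_product (\<theta> e *\<^sub>R e + u) \<beta>))"
    by (simp add: ip inn interior_product_anticommute[of u e])
  finally show ?case
    by (simp add: inner_on_Cons u_def)
qed

lemma form_apply_move_front:
  "form_apply \<alpha> (ys @ e # zs) = (-1) ^ length ys * form_apply \<alpha> (e # ys @ zs)"
proof (induction ys arbitrary: \<alpha>)
  case (Cons y ys)
  have "form_apply \<alpha> (y # ys @ e # zs) = form_apply (interior_product y \<alpha>) (ys @ e # zs)"
    by (simp add: interior_product.rep_eq)
  also have "\<dots> = (-1) ^ length ys * form_apply (interior_product e (interior_product y \<alpha>)) (ys @ zs)"
    unfolding Cons.IH by (simp add: interior_product.rep_eq)
  also have "\<dots> = (-1) ^ length (y # ys) * form_apply \<alpha> (e # y # ys @ zs)"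
    unfolding interior_product_anticommute[of e y]
    by (simp add: interior_product.rep_eq uminus_alt_form.rep_eq)
  finally show ?case by simp
qed simp

lemma inner_on_self_nonneg: "inner_on E \<alpha> \<alpha> \<ge> 0"
  by (simp add: inner_on_def sum_nonneg)

text \<open>Definiteness of a sum of squares: both parts given by \<open>inner_on_Cons\<close>
  vanish. If \<open>e\<close> occurs among the arguments, it is moved to the front; either it is
  repeated there, or the contraction with \<open>e\<close> is evaluated on members of the
  tail.\<close>

lemma form_apply_eq_0_of_inner_on:
  assumes "inner_on E \<alpha> \<alpha> = 0" "set vs \<subseteq> set E"
  shows "form_apply \<alpha> vs = 0"
  using assms
proof (induction E arbitrary: \<alpha> vs)
  case Nil
  then show ?case by (simp add: inner_on_Nil)
next
  case (Cons e E)
  have 0: "inner_on E \<alpha> \<alpha> = 0" "inner_on E (interior_product e \<alpha>) (interior_product e \<alpha>) = 0"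
    using Cons.prems(1) inner_on_self_nonneg[of E \<alpha>] inner_on_self_nonneg[of E "interior_product e \<alpha>"]
    by (simp_all add: inner_on_Cons)
  show ?case
  proof (cases "e \<in> set vs")
    case False
    then show ?thesis using Cons.IH[OF 0(1)] Cons.prems(2) by auto
  next
    case True
    then obtain ys zs where vs: "vs = ys @ e # zs"
      by (meson split_list)
    have "form_apply \<alpha> (e # ys @ zs) = 0"
    proof (cases "e \<in> set (ys @ zs)")
      case True
      then show ?thesis by (intro form_apply_not_distinct) auto
    next
      case False
      then have "set (ys @ zs) \<subseteq> set E"
        using Cons.prems(2) vs by auto
      from Cons.IH[OF 0(2) this] show ?thesis
        by (simp add: interior_product.rep_eq)
    qed
    then show ?thesis
      unfolding vs form_apply_move_front by simp
  qed
qed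

lemma form_eq_0_of_spanning:
  assumes "span B = UNIV" "\<And>vs. set vs \<subseteq> B \<Longrightarrow> form_apply \<alpha> vs = 0"
  shows "\<alpha> = 0"
proof (rule form_eqI)
  \<comment> \<open>Multilinearity is used one slot at a time: members of \<open>B\<close>
    accumulate in the prefix \<open>vs\<close>, while \<open>us\<close> consists of arbitrary
    vectors.\<close>
  have "form_apply \<alpha> (vs @ us) = 0" if "set vs \<subseteq> B" for vs us
    using that
  proof (induction us arbitrary: vs)
    case Nil
    then show ?case by (simp add: assms(2))
  next
    case (Cons u us)
    have "u \<in> span B"
      by (simp add: assms(1))
    moreover have "form_apply \<alpha> (vs @ b # us) = 0" if "b \<in> B" for b
      using Cons.IH[of "vs @ [b]"] Cons.prems that by simp
    ultimately show ?case
      using linear_eq_0_on_span[OF linear_form_apply] by blast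
  qed
  from this[of "[]"] show "form_apply \<alpha> vs = form_apply 0 vs" for vs
    by (simp add: zero_alt_form.rep_eq)
qed

text \<open>Both sides are linear in \<open>u\<close> and agree on the spanning vectors of
  \<open>E\<close>.\<close>

lemma orthonormal_basis_sum_scaleR:
  fixes h :: "'e::euclidean_space \<Rightarrow>\<^sub>L 'e \<Rightarrow>\<^sub>L real"
  assumes "orthonormal_basis h E"
  shows "(\<Sum>e\<leftarrow>E. h u e *\<^sub>R e) = u"
proof -
  have sl: "(\<Sum>e\<leftarrow>E. h u e *\<^sub>R e) = (\<Sum>k<length E. h u (E ! k) *\<^sub>R (E ! k))" for u
    by (simp add: sum_list_sum_nth atLeast0LessThan)
  have lin: "linear (\<lambda>u. (\<Sum>k<length E. h u (E ! k) *\<^sub>R (E ! k)) - u)"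
    by (intro linear_compose_sub linear_compose_sum linear_ident ballI)
      (rule linearI, simp_all add: blinfun.add_right blinfun.add_left blinfun.scaleR_right
        blinfun.scaleR_left scaleR_add_left)
  have "(\<Sum>k<length E. h b (E ! k) *\<^sub>R (E ! k)) - b = 0" if "b \<in> set E" for b
  proof -
    from that obtain j where j: "j < length E" "b = E ! j"
      by (auto simp: in_set_conv_nth)
    have "(\<Sum>k<length E. h b (E ! k) *\<^sub>R (E ! k)) = (\<Sum>k<length E. if j = k then E ! k else 0)"
      using assms j by (intro sum.cong) (auto simp: orthonormal_basis_def)
    then show ?thesis
      using j by simp
  qed
  moreover have "u \<in> span (set E)"
    using assms by (simp add: orthonormal_basis_def)
  ultimately have "(\<Sum>k<length E. h u (E ! k) *\<^sub>R (E ! k)) - u = 0"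
    by (rule linear_eq_0_on_span[OF lin])
  then show ?thesis
    by (simp add: sl)
qed

text \<open>The existence of some orthonormal basis guarantees that the one selected in
  \<open>form_inner\<close> is orthonormal too. Facts valid for all such bases therefore apply to
  it.\<close>

lemma form_inner_eq_inner_on:
  assumes "orthonormal_basis h E"
  obtains F where "orthonormal_basis h F" "form_inner h = inner_on F"
proof
  show "orthonormal_basis h (SOME E. orthonormal_basis h E)"
    by (rule someI) (rule assms)
  show "form_inner h = inner_on (SOME E. orthonormal_basis h E)"
    by (simp add: fun_eq_iff form_inner_def inner_on_def Let_def)
qed

text \<open>Over the selected basis the adjoint is the contraction with the orthonormal expansion of
  \<open>u\<close>, which is \<open>u\<close> itself.\<close>

lemma form_inner_covector_wedge:
  assumes "orthonormal_basis h E"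
  shows "form_inner h (covector_form (h u) \<and>\<^sub>F \<alpha>) \<beta> = form_inner h \<alpha> (interior_product u \<beta>)"
  using assms
  by (rule form_inner_eq_inner_on) (simp add: inner_on_covector_wedge orthonormal_basis_sum_scaleR)

lemma form_inner_right_cancel:
  assumes "orthonormal_basis h E" "\<And>\<alpha>. form_inner h \<alpha> \<beta> = form_inner h \<alpha> \<gamma>"
  shows "\<beta> = \<gamma>"
proof -
  obtain F where F: "orthonormal_basis h F" "form_inner h = inner_on F"
    using assms(1) by (rule form_inner_eq_inner_on)
  have "inner_on F (\<beta> - \<gamma>) (\<beta> - \<gamma>) = 0"
    using assms(2) by (simp add: F(2) linear_diff[OF linear_inner_on_right])
  then have "\<beta> - \<gamma> = 0"
    using F(1) by (intro form_eq_0_of_spanning[of "set F"] form_apply_eq_0_of_inner_on)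
      (auto simp: orthonormal_basis_def)
  then show ?thesis by simp
qed

lemma linear_form_inner:
  assumes "orthonormal_basis h E"
  shows "linear (\<lambda>\<alpha>. form_inner h \<alpha> \<beta>)" "linear (form_inner h \<alpha>)"
  using form_inner_eq_inner_on[OF assms] linear_inner_on_left linear_inner_on_right by metis+

text \<open>Nondegeneracy makes the adjoint unique, so the choice in \<open>adjoint_op\<close> has
  only one candidate.\<close>

lemma adjoint_op_eqI:
  assumes "orthonormal_basis (g p) E"
    and "\<And>\<alpha> \<beta>. form_inner (g p) (S p \<alpha>) \<beta> = form_inner (g p) \<alpha> (T \<beta>)"
  shows "adjoint_op g S p = T"
  unfolding adjoint_op_def
proof (rule some_equality)
  fix T' assume "\<forall>\<alpha> \<beta>. form_inner (g p) (S p \<alpha>) \<beta> = form_inner (g p) \<alpha> (T' \<beta>)"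
  then have "T' \<beta> = T \<beta>" for \<beta>
    using assms(2) by (intro form_inner_right_cancel[OF assms(1)]) metis
  then show "T' = T" ..
qed (use assms(2) in blast)

section \<open>Fermionic operators on a fibre\<close>

definition wedge_endo :: "'e::euclidean_space alt_form \<Rightarrow> 'e alt_form endo" where
  "wedge_endo \<omega> = Endo (\<lambda>\<alpha>. \<omega> \<and>\<^sub>F \<alpha>)"

definition interior_endo :: "'e::euclidean_space \<Rightarrow> 'e alt_form endo" where
  "interior_endo v = Endo (interior_product v)"

lemma endo_apply_wedge_endo: "endo_apply (wedge_endo \<omega>) \<alpha> = \<omega> \<and>\<^sub>F \<alpha>"
  by (simp add: wedge_endo_def Endo_inverse linear_wedge_right)

lemma endo_apply_interior_endo: "endo_apply (interior_endo v) \<alpha> = interior_product v \<alpha>"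
  by (simp add: interior_endo_def Endo_inverse linear_interior_product_right)

lemma endo_eqI: "(\<And>x. endo_apply S x = endo_apply T x) \<Longrightarrow> S = T"
  by (simp add: endo_apply_inject[symmetric] fun_eq_iff)

lemmas endo_rep_eqs = zero_endo.rep_eq one_endo.rep_eq plus_endo.rep_eq minus_endo.rep_eq
  uminus_endo.rep_eq times_endo.rep_eq scaleR_endo.rep_eq

lemma wedge_endo_covector_anticommute:
  "wedge_endo (covector_form \<theta>) * wedge_endo (covector_form \<eta>)
   = - (wedge_endo (covector_form \<eta>) * wedge_endo (covector_form \<theta>))"
  by (rule endo_eqI)
    (simp add: endo_rep_eqs endo_apply_wedge_endo covector_wedge_anticommute[of \<theta>])

lemma interior_endo_anticommute:
  "interior_endo u * interior_endo v = - (interior_endo v * interior_endo u)"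
  by (rule endo_eqI)
    (simp add: endo_rep_eqs endo_apply_interior_endo interior_product_anticommute[of u])

lemma interior_endo_wedge_endo:
  "interior_endo v * wedge_endo (covector_form \<theta>)
   = \<theta> v *\<^sub>R 1 - wedge_endo (covector_form \<theta>) * interior_endo v"
  by (rule endo_eqI)
    (simp add: endo_rep_eqs endo_apply_interior_endo endo_apply_wedge_endo
      interior_product_covector_wedge)

lemma endo_alt_form_nontrivial: "(1 :: 'e::euclidean_space alt_form endo) \<noteq> 0"
proof
  assume 1: "(1 :: 'e alt_form endo) = 0"
  obtain b :: 'e where "b \<in> Basis"
    using nonempty_Basis by blast
  have "covector_form (blinfun_inner_left b) = 0"
    using arg_cong[OF 1, of "\<lambda>T. endo_apply T (covector_form (blinfun_inner_left b))"]
    by (simp add: endo_rep_eqs)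
  then have "form_apply (covector_form (blinfun_inner_left b)) [b] = form_apply 0 [b]"
    by (rule arg_cong)
  then show False
    using \<open>b \<in> Basis\<close> by (simp add: covector_form.rep_eq zero_alt_form.rep_eq)
qed

text \<open>Wedging with the dual basis covectors gives the creators and contracting with the basis
  vectors the annihilators. The forms are sums of products of two covectors, so by associativity
  their wedge operators are sums of products of two creators.\<close>

lemma orthonormal_std_basis_sl4_generators:
  fixes h :: "'e::euclidean_space \<Rightarrow>\<^sub>L 'e \<Rightarrow>\<^sub>L real"
  assumes basis: "orthonormal_std_basis n h \<omega>1 \<omega>2 v w1 w2"
    and \<omega>D: "\<omega>D = (\<Sum>i<n. covector_form (h (w1 i)) \<and>\<^sub>F covector_form (h (w2 i)))"
    and "n > 0"
  obtains l m :: "4 \<Rightarrow> 'e alt_form endo" where "sl4_generators l m" "l 1 \<noteq> 0"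
    "endo_apply (l 1) = (\<lambda>\<alpha>. \<omega>D \<and>\<^sub>F \<alpha>)" "endo_apply (l 2) = (\<lambda>\<alpha>. \<omega>1 \<and>\<^sub>F \<alpha>)"
    "endo_apply (l 3) = (\<lambda>\<alpha>. \<omega>2 \<and>\<^sub>F \<alpha>)"
    "\<And>i \<alpha> \<beta>. form_inner h (endo_apply (l i) \<alpha>) \<beta> = form_inner h \<alpha> (endo_apply (m i) \<beta>)"
proof -
  define E where "E = map v [0..<n] @ map w1 [0..<n] @ map w2 [0..<n]"
  have E: "orthonormal_basis h E"
    and \<omega>1: "\<omega>1 = (\<Sum>i<n. covector_form (h (v i)) \<and>\<^sub>F covector_form (h (w1 i)))"
    and \<omega>2: "\<omega>2 = (\<Sum>i<n. covector_form (h (v i)) \<and>\<^sub>F covector_form (h (w2 i)))"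
    using basis by (simp_all add: orthonormal_std_basis_def E_def)
  have nth: "E ! i = v i" "E ! (n + i) = w1 i" "E ! (n + n + i) = w2 i" if "i < n" for i
    using that by (simp_all add: E_def nth_append add.assoc)
  define c where "c k = wedge_endo (covector_form (h (E ! k)))" for k
  define a where "a k = interior_endo (E ! k)" for k
  define l where "l i = (\<Sum>s<n. fermion_l n c s i)" for i
  define m where "m i = (\<Sum>s<n. fermion_m n a s i)" for i
  \<comment> \<open>Contraction and wedging anticommute up to the value of the covector
    \<open>k\<close> on the vector \<open>j\<close>, which orthonormality makes a Kronecker
    delta.\<close>
  have ac: "a j * c k = (if j = k then 1 else 0) - c k * a j"
    if "j < n + n + n" "k < n + n + n" for j k
    using E that by (auto simp: a_def c_def interior_endo_wedge_endo orthonormal_basis_def E_def)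
  have cc: "c j * c k = - (c k * c j)" for j k
    unfolding c_def by (rule wedge_endo_covector_anticommute)
  have aa: "a j * a k = - (a k * a j)" for j k
    unfolding a_def by (rule interior_endo_anticommute)
  have sl4: "sl4_generators l m"
    unfolding l_def[abs_def] m_def[abs_def]
    using cc aa ac by (rule sl4_generators_fermion)
  have nz: "l 1 \<noteq> 0"
    unfolding l_def using ac \<open>n > 0\<close> endo_alt_form_nontrivial by (rule fermion_l_sum_nonzero)
  have wedge_sum: "(\<Sum>i<n. \<theta> i \<and>\<^sub>F \<eta> i) \<and>\<^sub>F \<alpha> = (\<Sum>i<n. \<theta> i \<and>\<^sub>F \<eta> i \<and>\<^sub>F \<alpha>)" for \<theta> \<eta> and \<alpha> :: "'e alt_form"
    by (simp add: linear_sum[OF linear_wedge_left] wedge_assoc)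
  have l: "endo_apply (l 1) = (\<lambda>\<alpha>. \<omega>D \<and>\<^sub>F \<alpha>)" "endo_apply (l 2) = (\<lambda>\<alpha>. \<omega>1 \<and>\<^sub>F \<alpha>)"
    "endo_apply (l 3) = (\<lambda>\<alpha>. \<omega>2 \<and>\<^sub>F \<alpha>)"
    by (auto simp: fun_eq_iff l_def endo_apply_sum fermion_l_def c_def times_endo.rep_eq
        endo_apply_wedge_endo nth \<omega>D \<omega>1 \<omega>2 wedge_sum)
  have pair: "form_inner h (endo_apply (c j * c k) \<alpha>) \<beta> = form_inner h \<alpha> (endo_apply (a k * a j) \<beta>)" for j k \<alpha> \<beta>
    by (simp add: c_def a_def times_endo.rep_eq endo_apply_wedge_endo endo_apply_interior_endo
        form_inner_covector_wedge[OF E])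
  have copy: "form_inner h (endo_apply (fermion_l n c s i) \<alpha>) \<beta> = form_inner h \<alpha> (endo_apply (fermion_m n a s i) \<beta>)"
    for s i \<alpha> \<beta>
    by (simp add: fermion_l_def fermion_m_def pair)
  have adj: "form_inner h (endo_apply (l i) \<alpha>) \<beta> = form_inner h \<alpha> (endo_apply (m i) \<beta>)" for i \<alpha> \<beta>
    by (simp add: l_def m_def endo_apply_sum linear_sum[OF linear_form_inner(1)[OF E]]
        linear_sum[OF linear_form_inner(2)[OF E]] copy)
  show ?thesis
    using that[OF sl4 nz l adj] .
qed

section \<open>The generated Lie algebra of bundle operators\<close>

lemma generated_Lie_algebra_sum:
  assumes "finite X" "\<And>x. x \<in> X \<Longrightarrow> f x \<in> generated_Lie_algebra G"
  shows "(\<lambda>p \<alpha>. \<Sum>x\<in>X. f x p \<alpha>) \<in> generated_Lie_algebra G"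
  using assms
proof (induction X rule: finite_induct)
  case empty
  then show ?case by (simp add: generated_Lie_algebra.zero)
next
  case (insert x X)
  then show ?case
    using generated_Lie_algebra.add[of "f x" G "\<lambda>p \<alpha>. \<Sum>x\<in>X. f x p \<alpha>"]
    by (simp add: op_add_def)
qed

theorem theorem7p2:
  fixes A :: "('x::{t2_space, second_countable_topology}, 'e::euclidean_space) chart set"
    and n :: nat
    and \<omega>1 \<omega>2 \<omega>D :: "'x \<Rightarrow> 'e alt_form"
    and g :: "'x \<Rightarrow> 'e \<Rightarrow>\<^sub>L 'e \<Rightarrow>\<^sub>L real"
    and L0 L1 L2 :: "('x, 'e) bundle_op"
  assumes "almost_2_Kaehler n A \<omega>1 \<omega>2 g"
    and "dualizing_form n \<omega>1 \<omega>2 g \<omega>D"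
    and "L0 = wedge_op \<omega>D" and "L1 = wedge_op \<omega>1" and "L2 = wedge_op \<omega>2"
  shows "\<exists>\<rho>. sl4_isomorphism \<rho> (generated_Lie_algebra
                 {L0, L1, L2, adjoint_op g L0, adjoint_op g L1, adjoint_op g L2})
           \<and> \<rho> (matrix_unit 1 0) = L0 \<and> \<rho> (matrix_unit 0 1) = adjoint_op g L0
           \<and> \<rho> (matrix_unit 2 0) = L1 \<and> \<rho> (matrix_unit 0 2) = adjoint_op g L1
           \<and> \<rho> (matrix_unit 3 0) = L2 \<and> \<rho> (matrix_unit 0 3) = adjoint_op g L2"
proof -
  have "DIM('e) = 3 * n"
    using assms(1) by (simp add: almost_2_Kaehler_def)
  then have "n > 0"
    using DIM_positive[where 'a = 'e] by (cases n) auto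
  have "\<exists>l m. sl4_generators l m \<and> l 1 \<noteq> (0 :: 'e alt_form endo)
      \<and> endo_apply (l 1) = L0 p \<and> endo_apply (l 2) = L1 p \<and> endo_apply (l 3) = L2 p
      \<and> endo_apply (m 1) = adjoint_op g L0 p \<and> endo_apply (m 2) = adjoint_op g L1 p
      \<and> endo_apply (m 3) = adjoint_op g L2 p" for p
  proof -
    from assms(2) obtain v w1 w2 where basis: "orthonormal_std_basis n (g p) (\<omega>1 p) (\<omega>2 p) v w1 w2"
      and \<omega>D: "\<omega>D p = (\<Sum>i<n. covector_form (g p (w1 i)) \<and>\<^sub>F covector_form (g p (w2 i)))"
      unfolding dualizing_form_def by meson
    from basis obtain E where E: "orthonormal_basis (g p) E"
      unfolding orthonormal_std_basis_def by blast
    from basis \<omega>D \<open>n > 0\<close> obtain l m :: "4 \<Rightarrow> 'e alt_form endo" where lm: "sl4_generators l m" "l 1 \<noteq> 0"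
      "endo_apply (l 1) = (\<lambda>\<alpha>. \<omega>D p \<and>\<^sub>F \<alpha>)" "endo_apply (l 2) = (\<lambda>\<alpha>. \<omega>1 p \<and>\<^sub>F \<alpha>)"
      "endo_apply (l 3) = (\<lambda>\<alpha>. \<omega>2 p \<and>\<^sub>F \<alpha>)"
      and adj: "\<And>i \<alpha> \<beta>. form_inner (g p) (endo_apply (l i) \<alpha>) \<beta> = form_inner (g p) \<alpha> (endo_apply (m i) \<beta>)"
      by (rule orthonormal_std_basis_sl4_generators) (rule that; assumption)
    have L: "L0 p = endo_apply (l 1)" "L1 p = endo_apply (l 2)" "L2 p = endo_apply (l 3)"
      by (simp_all add: assms(3-5) lm wedge_op_def)
    have "adjoint_op g L0 p = endo_apply (m 1)" "adjoint_op g L1 p = endo_apply (m 2)"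
      "adjoint_op g L2 p = endo_apply (m 3)"
      by (rule adjoint_op_eqI[of g p, OF E]; simp add: L adj)+
    with lm L show ?thesis by (intro exI[of _ l] exI[of _ m]) simp
  qed
  \<comment> \<open>The generators are chosen at each point separately; a \<open>bundle_op\<close>
    is an arbitrary family of fibre maps, so neighbouring fibres need not be compared.\<close>
  then obtain l m where gens: "\<And>p. sl4_generators (l p) (m p)" and l1: "\<And>p. l p 1 \<noteq> (0 :: 'e alt_form endo)"
    and l: "\<And>p. endo_apply (l p 1) = L0 p" "\<And>p. endo_apply (l p 2) = L1 p" "\<And>p. endo_apply (l p 3) = L2 p"
    and m: "\<And>p. endo_apply (m p 1) = adjoint_op g L0 p" "\<And>p. endo_apply (m p 2) = adjoint_op g L1 p"
      "\<And>p. endo_apply (m p 3) = adjoint_op g L2 p"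
    by metis
  define R where "R p = sl4_generators.rep (l p) (m p)" for p
  define \<rho> where "\<rho> M = (\<lambda>p. endo_apply (R p M))" for M
  let ?G = "{L0, L1, L2, adjoint_op g L0, adjoint_op g L1, adjoint_op g L2}"
  note lin = sl4_generators.rep_linear[OF gens, folded R_def]
  note unit = sl4_generators.rep_matrix_unit[OF gens, folded R_def]
    sl4_generators.unit_op_simps[OF gens]
  have units: "\<rho> (matrix_unit 1 0) = L0" "\<rho> (matrix_unit 0 1) = adjoint_op g L0"
    "\<rho> (matrix_unit 2 0) = L1" "\<rho> (matrix_unit 0 2) = adjoint_op g L1"
    "\<rho> (matrix_unit 3 0) = L2" "\<rho> (matrix_unit 0 3) = adjoint_op g L2"
    by (simp_all add: \<rho>_def fun_eq_iff unit l m)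
  have \<rho>_add: "\<rho> (M + N) = op_add (\<rho> M) (\<rho> N)" for M N
    by (simp add: \<rho>_def op_add_def linear_add[OF lin] plus_endo.rep_eq)
  have \<rho>_scale: "\<rho> (r *\<^sub>R M) = op_scale r (\<rho> M)" for r M
    by (simp add: \<rho>_def op_scale_def linear_scale[OF lin] scaleR_endo.rep_eq)
  have \<rho>_commutator: "\<rho> (M ** N - N ** M) = op_commutator (\<rho> M) (\<rho> N)" for M N
    by (simp add: \<rho>_def op_commutator_def R_def sl4_generators.rep_commutator[OF gens]
        commutator_def minus_endo.rep_eq times_endo.rep_eq)
  have "inj_on \<rho> sl4"
  proof (rule inj_onI)
    fix M N assume MN: "M \<in> sl4" "N \<in> sl4" "\<rho> M = \<rho> N"
    \<comment> \<open>A single fibre already separates traceless matrices; \<open>undefined\<close>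
      serves as an arbitrary point of the manifold.\<close>
    then have "R undefined M = R undefined N"
      by (metis \<rho>_def endo_apply_inject)
    then have "R undefined (M - N) = 0"
      by (simp add: linear_diff[OF lin])
    moreover have "trace (M - N) = 0"
      using MN(1,2) by (simp add: sl4_def trace_sub)
    ultimately have "M - N = 0"
      unfolding R_def by (intro sl4_generators.rep_eq_0_imp[OF gens l1])
    then show "M = N" by simp
  qed
  moreover have "\<rho> ` sl4 = generated_Lie_algebra ?G"
  proof (intro equalityI subsetI)
    fix S assume "S \<in> generated_Lie_algebra ?G"
    then show "S \<in> \<rho> ` sl4"
    \<comment> \<open>The image contains the generators, as off-diagonal matrix units are traceless,
      and is closed under the operations because sl(4) is a Lie algebra and \<rho> a
      homomorphism.\<close>
    proof induction
      case (generator S)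
      have "matrix_unit i j \<in> sl4" if "i \<noteq> j" for i j
        using that by (auto simp: sl4_def trace_def matrix_unit_def intro!: sum.neutral)
      then have "\<rho> (matrix_unit i 0) \<in> \<rho> ` sl4" "\<rho> (matrix_unit 0 i) \<in> \<rho> ` sl4" if "i \<noteq> 0" for i
        using that by auto
      from this[of 1] this[of 2] this[of 3] show ?case
        using generator by (auto simp: units)
    next
      case zero
      have "(\<lambda>p \<alpha>. 0) = \<rho> 0"
        by (simp add: \<rho>_def linear_0[OF lin] zero_endo.rep_eq)
      then show ?case
        by (intro image_eqI[of _ _ 0]) (simp_all add: sl4_def trace_def)
    next
      case (add S T)
      then obtain M N where "M \<in> sl4" "N \<in> sl4" "S = \<rho> M" "T = \<rho> N"
        by blast
      then show ?case
        by (intro image_eqI[of _ _ "M + N"]) (simp_all add: \<rho>_add sl4_def trace_add)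
    next
      case (scale S r)
      then obtain M where "M \<in> sl4" "S = \<rho> M"
        by blast
      then show ?case
        by (intro image_eqI[of _ _ "r *\<^sub>R M"])
          (simp_all add: \<rho>_scale sl4_def trace_def flip: sum_distrib_left)
    next
      case (commutator S T)
      then obtain M N where "M \<in> sl4" "N \<in> sl4" "S = \<rho> M" "T = \<rho> N"
        by blast
      then show ?case
        by (intro image_eqI[of _ _ "M ** N - N ** M"])
          (simp_all add: \<rho>_commutator sl4_def trace_sub trace_mul_sym[of M N])
    qed
  next
    fix S assume "S \<in> \<rho> ` sl4"
    then obtain M where M: "trace M = 0" "S = \<rho> M"
      by (auto simp: sl4_def)
    let ?L = "generated_Lie_algebra ?G"
    define l' m' where "l' i = (\<lambda>p. endo_apply (l p i))" and "m' i = (\<lambda>p. endo_apply (m p i))" for i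
    have in_L: "l' i \<in> ?L" "m' i \<in> ?L" if "i \<in> - {0}" for i
    proof -
      have "i = 1 \<or> i = 2 \<or> i = 3"
        using that exhaust_4[of i] by auto
      then show "l' i \<in> ?L" "m' i \<in> ?L"
        by (auto simp: l'_def m'_def l m intro!: generated_Lie_algebra.generator)
    qed
    \<comment> \<open>The expansion \<open>rep_sl4\<close> has the same real coefficients in every
      fibre, so it is an identity of bundle operators built from the generators and their
      brackets.\<close>
    have "S = op_add (op_add (\<lambda>p \<alpha>. \<Sum>i\<in>-{0}. op_scale (M $ i $ 0) (l' i) p \<alpha>)
          (\<lambda>p \<alpha>. \<Sum>i\<in>-{0}. op_scale (M $ 0 $ i) (m' i) p \<alpha>))
        (\<lambda>p \<alpha>. \<Sum>i\<in>-{0}. \<Sum>j\<in>-{0}. op_scale (M $ i $ j) (op_commutator (l' i) (m' j)) p \<alpha>)"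
      by (simp add: M(2) \<rho>_def R_def sl4_generators.rep_sl4[OF gens M(1)] op_add_def op_scale_def
          op_commutator_def l'_def m'_def commutator_def endo_apply_sum endo_rep_eqs fun_eq_iff)
    also have "\<dots> \<in> ?L"
      by (intro generated_Lie_algebra.add generated_Lie_algebra.scale
          generated_Lie_algebra.commutator generated_Lie_algebra_sum in_L finite)
    finally show "S \<in> ?L" .
  qed
  ultimately have "bij_betw \<rho> sl4 (generated_Lie_algebra ?G)"
    by (simp add: bij_betw_def)
  moreover have "linear (\<rho> M p)" for M p
    using endo_apply[of "R p M"] by (simp add: \<rho>_def)
  ultimately have "sl4_isomorphism \<rho> (generated_Lie_algebra ?G)"
    using \<rho>_add \<rho>_scale \<rho>_commutator by (simp add: sl4_isomorphism_def)
  with units show ?thesis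
    by blast
qed

end
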